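(* Let $m\ge2$ and $k\in\{1,\dots,m-1\}$ be integers. For every real $\alpha<\inf\left(\frac{k+1}{m+1},\frac{m-k}{m+1}\right)$ there is a constant $C$ (independent of $\varphi$) such that $$\int_{\mathbb{P}_m\mathbb{C}}\exp(-\alpha\varphi)\,dv\le C$$ for every $g$-admissible, $G$-invariant function $\varphi\in C^\infty(\mathbb{P}_m\mathbb{C})$ satisfying $\sup_{\mathbb{P}_m\mathbb{C}}\varphi=0$.
   Context: $\mathbb{P}_m\mathbb{C}$ is complex projective space of complex dimension $m$, with homogeneous coordinates $[z_0,\dots,z_m]$. Write $\partial_{\lambda\bar\mu}=\frac{\partial^2}{\partial z_\lambda\partial\bar z_\mu}$. Metric: $g$ is the Kähler metric on $\mathbb{P}_m\mathbb{C}$ with components, in the chart $\{z_0\ne0\}$ (normalised by $z_0=1$), $g_{\lambda\bar\mu}=(m+1)\,\partial_{\lambda\bar\mu}\ln(1+|z_1|^2+\dots+|z_m|^2)$; $dv$ is the volume element of $g$. A real function $\varphi\in C^\infty(\mathbb{P}_m\mathbb{C})$ is $g$-admissible if the Hermitian matrix $(g_{\lambda\bar\mu}+\partial_{\lambda\bar\mu}\varphi)$ is positive definite at every point of $\mathbb{P}_m\mathbb{C}$. Group: $G$ is the group of automorphisms of $\mathbb{P}_m\mathbb{C}$ generated by: the $\sigma_{i,j}$ for $i,j\in\{0,\dots,k\}$, exchanging the homogeneous coordinates $z_i$ and $z_j$; the $\varphi_{p,q}$ for $p,q\in\{k+1,\dots,m\}$, exchanging $z_p$ and $z_q$; and the $\tau_{l,\theta}$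 for $l\in\{0,\dots,m\}$, $\theta\in[0,2\pi]$, replacing $z_l$ by $z_le^{i\theta}$. *)

theory Defs
  imports
    "HOL-Analysis.Analysis"
    "HOL-Algebra.Bij"
    "HOL-Algebra.Generated_Groups"
    "Jordan_Normal_Form.Determinant"
begin

section \<open>Complex projective space\<close>

text \<open>
  A vector \<open>(z\<^sub>0, \<dots>, z\<^sub>m)\<close> of \<open>\<complex>\<^sup>m\<^sup>+\<^sup>1\<close> is a function \<open>nat \<Rightarrow> complex\<close> vanishing beyond \<open>m\<close>.
  On such functions the library's topology of \<open>nat \<Rightarrow> complex\<close> (the product topology) induces the
  Euclidean one.
\<close>

definition hvec :: "nat \<Rightarrow> (nat \<Rightarrow> complex) set" where
  "hvec m = {z. (\<forall>j>m. z j = 0) \<and> (\<exists>j\<le>m. z j \<noteq> 0)}"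

definition proj_rel :: "nat \<Rightarrow> ((nat \<Rightarrow> complex) \<times> (nat \<Rightarrow> complex)) set" where
  "proj_rel m = {(z, w). z \<in> hvec m \<and> w \<in> hvec m \<and> (\<exists>c. c \<noteq> 0 \<and> w = (\<lambda>j. c * z j))}"

lemma equiv_proj_rel: "equiv (hvec m) (proj_rel m)"
proof (rule equivI)
  show "proj_rel m \<subseteq> hvec m \<times> hvec m" by (auto simp: proj_rel_def)
  show "refl_on (hvec m) (proj_rel m)"
    unfolding refl_on_def proj_rel_def by (auto intro!: exI[of _ 1])
  show "sym (proj_rel m)" unfolding sym_def proj_rel_def
    apply (auto) subgoal for x c by (rule exI[of _ "1/c"]) auto done
  show "trans (proj_rel m)" unfolding trans_def proj_rel_def
    apply (auto) subgoal for x c d by (rule exI[of _ "d*c"]) auto done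
qed

definition cproj :: "nat \<Rightarrow> (nat \<Rightarrow> complex) set set" where
  "cproj m = hvec m // proj_rel m"

definition proj_pt :: "nat \<Rightarrow> (nat \<Rightarrow> complex) \<Rightarrow> (nat \<Rightarrow> complex) set" where
  "proj_pt m z = proj_rel m `` {z}"

text \<open>
  The affine chart \<open>z\<^sub>i \<noteq> 0\<close> is parametrised by its normalised representatives \<open>z\<^sub>i = 1\<close>; the
  complex coordinates of the chart are the \<open>z\<^sub>j\<close> with \<open>j \<in> chart_idx m i\<close>. A function on
  the projective space read in this chart is \<open>\<lambda>z. f (proj_pt m z)\<close>, restricted to \<open>chart m i\<close>.
\<close>

definition chart :: "nat \<Rightarrow> nat \<Rightarrow> (nat \<Rightarrow> complex) set" where
  "chart m i = {z. (\<forall>j>m. z j = 0) \<and> z i = 1}"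

definition chart_idx :: "nat \<Rightarrow> nat \<Rightarrow> nat set" where
  "chart_idx m i = {0..m} - {i}"


section \<open>Differential calculus in a chart\<close>

definition dir_deriv ::
  "nat \<times> complex \<Rightarrow> ((nat \<Rightarrow> complex) \<Rightarrow> 'a::real_normed_vector) \<Rightarrow> (nat \<Rightarrow> complex) \<Rightarrow> 'a" where
  "dir_deriv d f z =
     vector_derivative (\<lambda>t::real. f (z(fst d := z (fst d) + of_real t * snd d))) (at 0)"

definition dir_differentiable ::
  "nat \<times> complex \<Rightarrow> ((nat \<Rightarrow> complex) \<Rightarrow> 'a::real_normed_vector) \<Rightarrow> (nat \<Rightarrow> complex) \<Rightarrow> bool" where
  "dir_differentiable d f z \<longleftrightarrow>
     (\<lambda>t::real. f (z(fst d := z (fst d) + of_real t * snd d))) differentiable (at 0)"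

text \<open>The real coordinate directions \<open>\<partial>/\<partial>x\<^sub>j\<close> and \<open>\<partial>/\<partial>y\<^sub>j\<close>, where \<open>z\<^sub>j = x\<^sub>j + \<i> y\<^sub>j\<close>, of a chart:\<close>

definition real_dirs :: "nat \<Rightarrow> nat \<Rightarrow> (nat \<times> complex) set" where
  "real_dirs m i = chart_idx m i \<times> {1, \<i>}"

text \<open>
  \<open>C\<^sup>\<infinity>\<close> means that all iterated real partial derivatives, of all orders, exist and are continuous;
  a function on the projective space is smooth if it is so in each of the \<open>m + 1\<close> affine charts.
\<close>

definition smooth_chart ::
  "nat \<Rightarrow> nat \<Rightarrow> ((nat \<Rightarrow> complex) \<Rightarrow> 'a::real_normed_vector) \<Rightarrow> bool" where
  "smooth_chart m i f \<longleftrightarrow>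
     (\<forall>ds \<in> lists (real_dirs m i).
        continuous_on (chart m i) (foldr dir_deriv ds f) \<and>
        (\<forall>d \<in> real_dirs m i. \<forall>z \<in> chart m i. dir_differentiable d (foldr dir_deriv ds f) z))"

definition smooth_cproj :: "nat \<Rightarrow> ((nat \<Rightarrow> complex) set \<Rightarrow> real) \<Rightarrow> bool" where
  "smooth_cproj m \<phi> \<longleftrightarrow> (\<forall>i\<le>m. smooth_chart m i (\<lambda>z. \<phi> (proj_pt m z)))"

definition dz :: "nat \<Rightarrow> ((nat \<Rightarrow> complex) \<Rightarrow> complex) \<Rightarrow> (nat \<Rightarrow> complex) \<Rightarrow> complex" where
  "dz j f z = (dir_deriv (j, 1) f z - \<i> * dir_deriv (j, \<i>) f z) / 2"

definition dzbar :: "nat \<Rightarrow> ((nat \<Rightarrow> complex) \<Rightarrow> complex) \<Rightarrow> (nat \<Rightarrow> complex) \<Rightarrow> complex" where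
  "dzbar j f z = (dir_deriv (j, 1) f z + \<i> * dir_deriv (j, \<i>) f z) / 2"

definition ddbar :: "nat \<Rightarrow> nat \<Rightarrow> ((nat \<Rightarrow> complex) \<Rightarrow> real) \<Rightarrow> (nat \<Rightarrow> complex) \<Rightarrow> complex" where
  "ddbar a b f = dz a (dzbar b (\<lambda>z. complex_of_real (f z)))"


section \<open>Metric, volume element and admissible functions\<close>

text \<open>
  On \<open>chart m 0\<close> the argument of the logarithm below is \<open>1 + |z\<^sub>1|\<^sup>2 + \<dots> + |z\<^sub>m|\<^sup>2\<close>. The same
  formula gives the components of the metric in every chart \<open>z\<^sub>i = 1\<close>: on overlaps the potentials
  differ by a multiple of \<open>ln |z\<^sub>i|\<^sup>2\<close>, which is pluriharmonic.
\<close>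

definition g_comp :: "nat \<Rightarrow> nat \<Rightarrow> nat \<Rightarrow> (nat \<Rightarrow> complex) \<Rightarrow> complex" where
  "g_comp m a b z = of_nat (m + 1) * ddbar a b (\<lambda>z. ln (\<Sum>j=0..m. (cmod (z j))\<^sup>2)) z"

definition pos_def_hermitian :: "nat set \<Rightarrow> (nat \<Rightarrow> nat \<Rightarrow> complex) \<Rightarrow> bool" where
  "pos_def_hermitian I H \<longleftrightarrow>
     (\<forall>a\<in>I. \<forall>b\<in>I. H b a = cnj (H a b)) \<and>
     (\<forall>v. (\<exists>a\<in>I. v a \<noteq> 0) \<longrightarrow> 0 < Re (\<Sum>a\<in>I. \<Sum>b\<in>I. H a b * v a * cnj (v b)))"

definition admissible :: "nat \<Rightarrow> ((nat \<Rightarrow> complex) set \<Rightarrow> real) \<Rightarrow> bool" where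
  "admissible m \<phi> \<longleftrightarrow>
     (\<forall>i\<le>m. \<forall>z \<in> chart m i.
        pos_def_hermitian (chart_idx m i)
          (\<lambda>a b. g_comp m a b z + ddbar a b (\<lambda>z. \<phi> (proj_pt m z)) z))"

text \<open>The Borel sets of the quotient topology (\<open>\<Union>U\<close> is the preimage of \<open>U\<close> in \<open>hvec m\<close>):\<close>

definition cproj_borel :: "nat \<Rightarrow> (nat \<Rightarrow> complex) set measure" where
  "cproj_borel m = sigma (cproj m) {U. U \<subseteq> cproj m \<and> openin (top_of_set (hvec m)) (\<Union>U)}"

definition affine_vec :: "nat \<Rightarrow> (nat \<Rightarrow> complex) \<Rightarrow> nat \<Rightarrow> complex" where
  "affine_vec m w = (\<lambda>j. if j = 0 then 1 else if j \<le> m then w j else 0)"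

lemma measurable_affine_chart: "(\<lambda>w. proj_pt m (affine_vec m w)) \<in> measurable (\<Pi>\<^sub>M j\<in>{1..m}. lborel) (cproj_borel m)"
  unfolding cproj_borel_def
proof (rule measurable_measure_of)
  show "{U. U \<subseteq> cproj m \<and> openin (top_of_set (hvec m)) (\<Union>U)} \<subseteq> Pow (cproj m)" by auto
  have hv: "affine_vec m w \<in> hvec m" for w by (auto simp: affine_vec_def hvec_def)
  show "(\<lambda>w. proj_pt m (affine_vec m w)) \<in> space (\<Pi>\<^sub>M j\<in>{1..m}. lborel) \<rightarrow> cproj m"
    using hv by (auto simp: cproj_def proj_pt_def quotient_def)
  fix U assume "U \<in> {U. U \<subseteq> cproj m \<and> openin (top_of_set (hvec m)) (\<Union>U)}"
  then have U: "U \<subseteq> cproj m" and "openin (top_of_set (hvec m)) (\<Union>U)" by auto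
  then obtain V where V: "open V" "\<Union>U = hvec m \<inter> V" by (auto simp: openin_open)
  have am: "affine_vec m \<in> borel_measurable (\<Pi>\<^sub>M j\<in>{1..m}. lborel)"
    apply (rule measurable_coordinatewise_then_product)
    subgoal for j apply (cases "j = 0"; cases "j \<le> m") by (auto simp: affine_vec_def intro!: measurable_PiM_component_rev measurable_component_singleton[of j "{1..m}" "\<lambda>_. lborel", simplified])
    done
  have "proj_pt m z \<in> U \<longleftrightarrow> z \<in> \<Union>U" if "z \<in> hvec m" for z
  proof
    assume "proj_pt m z \<in> U" then show "z \<in> \<Union>U"
      using equiv_class_self[OF equiv_proj_rel that] by (auto simp: proj_pt_def)
  next
    assume "z \<in> \<Union>U" then obtain p where p: "p \<in> U" "z \<in> p" by auto
    then have "p \<in> hvec m // proj_rel m" using U by (auto simp: cproj_def)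
    then obtain x where x: "p = proj_rel m `` {x}" by (rule quotientE)
    then have "(x, z) \<in> proj_rel m" using p(2) by simp
    then have "p = proj_pt m z"
      unfolding proj_pt_def x by (rule Equiv_Relations.equiv_class_eq[OF equiv_proj_rel])
    then show "proj_pt m z \<in> U" using p by simp
  qed
  then have "(\<lambda>w. proj_pt m (affine_vec m w)) -` U = affine_vec m -` V" using hv V by auto
  then show "(\<lambda>w. proj_pt m (affine_vec m w)) -` U \<inter> space (\<Pi>\<^sub>M j\<in>{1..m}. lborel) \<in> sets (\<Pi>\<^sub>M j\<in>{1..m}. lborel)"
    using measurable_sets[OF am borel_open[OF V(1)]] by simp
qed

text \<open>
  The volume element is \<open>det (g\<^sub>\<lambda>\<^sub>\<mu>)\<close> times Lebesgue measure in the chart \<open>z\<^sub>0 \<noteq> 0\<close>, whose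
  complement is a null set; that is, \<open>(\<i>/2)\<^sup>m det (g\<^sub>\<lambda>\<^sub>\<mu>) dz\<^sub>1 \<and> dz\<^sub>1\<^sup>* \<and> \<dots> \<and> dz\<^sub>m \<and> dz\<^sub>m\<^sup>*\<close>,
  with \<open>*\<close> for conjugation. Other conventions multiply it by a constant depending only on \<open>m\<close>.
\<close>

definition vol :: "nat \<Rightarrow> (nat \<Rightarrow> complex) set measure" where
  "vol m =
     distr
       (density (\<Pi>\<^sub>M j\<in>{1..m}. lborel)
         (\<lambda>w. ennreal (Re (Determinant.det
                (mat m m (\<lambda>(a, b). g_comp m (Suc a) (Suc b) (affine_vec m w)))))))
       (cproj_borel m) (\<lambda>w. proj_pt m (affine_vec m w))"


section \<open>The group\<close>

definition induced_map ::
  "nat \<Rightarrow> ((nat \<Rightarrow> complex) \<Rightarrow> (nat \<Rightarrow> complex)) \<Rightarrow> (nat \<Rightarrow> complex) set \<Rightarrow> (nat \<Rightarrow> complex) set" where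
  "induced_map m T = (\<lambda>p \<in> cproj m. T ` p)"

definition swap_coord :: "nat \<Rightarrow> nat \<Rightarrow> (nat \<Rightarrow> complex) \<Rightarrow> (nat \<Rightarrow> complex)" where
  "swap_coord i j z = z(i := z j, j := z i)"

definition rot_coord :: "nat \<Rightarrow> real \<Rightarrow> (nat \<Rightarrow> complex) \<Rightarrow> (nat \<Rightarrow> complex)" where
  "rot_coord l \<theta> z = z(l := z l * exp (\<i> * of_real \<theta>))"

definition G_gens :: "nat \<Rightarrow> nat \<Rightarrow> ((nat \<Rightarrow> complex) set \<Rightarrow> (nat \<Rightarrow> complex) set) set" where
  "G_gens m k =
     {induced_map m (swap_coord i j) | i j. i \<in> {0..k} \<and> j \<in> {0..k}} \<union>
     {induced_map m (swap_coord p q) | p q. p \<in> {k+1..m} \<and> q \<in> {k+1..m}} \<union>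
     {induced_map m (rot_coord l \<theta>) | l \<theta>. l \<in> {0..m} \<and> \<theta> \<in> {0..2 * pi}}"

lemma induced_map_Bij:
  assumes T: "\<And>z c. T (\<lambda>j. c * z j) = (\<lambda>j. c * T z j)"
    and S: "\<And>z c. S (\<lambda>j. c * z j) = (\<lambda>j. c * S z j)"
    and hT: "\<And>z. z \<in> hvec m \<Longrightarrow> T z \<in> hvec m" and hS: "\<And>z. z \<in> hvec m \<Longrightarrow> S z \<in> hvec m"
    and I: "\<And>z. S (T z) = z" "\<And>z. T (S z) = z"
  shows "induced_map m T \<in> Bij (cproj m)"
proof -
  have 1: "(T z, T w) \<in> proj_rel m" if "(z, w) \<in> proj_rel m" for z w
    using that hT T unfolding proj_rel_def by blast
  have 2: "(S z, S w) \<in> proj_rel m" if "(z, w) \<in> proj_rel m" for z w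
    using that hS S unfolding proj_rel_def by blast
  have a: "T ` (proj_rel m `` {z}) = proj_rel m `` {T z}" for z
  proof (intro subset_antisym subsetI)
    fix w assume "w \<in> proj_rel m `` {T z}"
    then have "(T z, w) \<in> proj_rel m" by blast
    then have "(z, S w) \<in> proj_rel m" using 2[of "T z" w] I by simp
    then show "w \<in> T ` (proj_rel m `` {z})" using I(2)[of w] by (metis ImageI image_eqI singletonI)
  qed (use 1 in blast)
  have b: "S ` (proj_rel m `` {z}) = proj_rel m `` {S z}" for z
  proof (intro subset_antisym subsetI)
    fix w assume "w \<in> proj_rel m `` {S z}"
    then have "(S z, w) \<in> proj_rel m" by blast
    then have "(z, T w) \<in> proj_rel m" using 1[of "S z" w] I by simp
    then show "w \<in> S ` (proj_rel m `` {z})" using I(1)[of w] by (metis ImageI image_eqI singletonI)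
  qed (use 2 in blast)
  have "bij_betw ((`) T) (cproj m) (cproj m)"
  proof (rule bij_betw_byWitness[where f' = "(`) S"])
    show "\<forall>p\<in>cproj m. S ` T ` p = p" "\<forall>p\<in>cproj m. T ` S ` p = p"
      by (simp_all add: image_image I)
    show "(`) T ` cproj m \<subseteq> cproj m"
      unfolding cproj_def by (auto elim!: quotientE simp: a intro!: quotientI hT)
    show "(`) S ` cproj m \<subseteq> cproj m"
      unfolding cproj_def by (auto elim!: quotientE simp: b intro!: quotientI hS)
  qed
  then have "bij_betw (induced_map m T) (cproj m) (cproj m)"
    by (subst bij_betw_cong[where g = "(`) T"]) (simp_all add: induced_map_def)
  then show ?thesis by (simp add: Bij_def induced_map_def)
qed

lemma swap_coord_hvec:
  assumes "i \<le> m" "j \<le> m" "z \<in> hvec m"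
  shows "swap_coord i j z \<in> hvec m"
proof -
  obtain l where l: "l \<le> m" "z l \<noteq> 0" using assms by (auto simp: hvec_def)
  have "swap_coord i j z (if l = i then j else if l = j then i else l) \<noteq> 0"
    using l by (auto simp: swap_coord_def)
  moreover have "(if l = i then j else if l = j then i else l) \<le> m" using l assms by simp
  ultimately have "\<exists>l\<le>m. swap_coord i j z l \<noteq> 0" by blast
  moreover have "\<forall>l>m. swap_coord i j z l = 0" using assms by (simp add: swap_coord_def hvec_def)
  ultimately show ?thesis by (simp add: hvec_def)
qed

lemma rot_coord_hvec:
  assumes "z \<in> hvec m" shows "rot_coord l \<theta> z \<in> hvec m"
proof -
  have *: "rot_coord l \<theta> z j = 0 \<longleftrightarrow> z j = 0" for j by (simp add: rot_coord_def)
  show ?thesis using assms unfolding hvec_def mem_Collect_eq * .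
qed

lemma G_gens_subset_Bij:
  assumes "k \<le> m" shows "G_gens m k \<subseteq> Bij (cproj m)"
proof -
  have sw: "induced_map m (swap_coord i j) \<in> Bij (cproj m)" if "i \<le> m" "j \<le> m" for i j
    by (rule induced_map_Bij[where S = "swap_coord i j"])
      (simp_all add: swap_coord_hvec that, simp_all add: swap_coord_def fun_eq_iff)
  have ro: "induced_map m (rot_coord l \<theta>) \<in> Bij (cproj m)" for l \<theta>
    by (rule induced_map_Bij[where S = "rot_coord l (- \<theta>)"])
      (simp_all add: rot_coord_hvec, simp_all add: rot_coord_def fun_eq_iff exp_minus)
  show ?thesis
    unfolding G_gens_def using assms by (auto intro!: sw ro)
qed

definition G_group :: "nat \<Rightarrow> nat \<Rightarrow> ((nat \<Rightarrow> complex) set \<Rightarrow> (nat \<Rightarrow> complex) set) set" where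
  "G_group m k = generate (BijGroup (cproj m)) (G_gens m k)"

definition G_invariant :: "nat \<Rightarrow> nat \<Rightarrow> ((nat \<Rightarrow> complex) set \<Rightarrow> real) \<Rightarrow> bool" where
  "G_invariant m k \<phi> \<longleftrightarrow> (\<forall>\<gamma> \<in> G_group m k. \<forall>p \<in> cproj m. \<phi> (\<gamma> p) = \<phi> p)"

end

theory Submission
  imports Defs
begin

text \<open>
  Write \<open>|z|\<^sup>2 = |z\<^sub>0|\<^sup>2 + \<dots> + |z\<^sub>m|\<^sup>2\<close>. The invariance of \<open>\<phi>\<close> under the rotations
  \<open>\<tau>\<^sub>l\<^sub>,\<^sub>\<theta>\<close> means that \<open>\<phi>\<close> depends on the moduli \<open>|z\<^sub>j| = exp x\<^sub>j\<close> only, and admissibility means that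
  \<open>u(x) = \<phi> + (m + 1) ln |z|\<^sup>2\<close> is convex in any two of the logarithmic radii \<open>x\<^sub>j\<close> (lemma
  \<open>convex_along_log_radii\<close>: at real points of a chart the complex Hessian of a rotation invariant
  function is a quarter of its Hessian in the logarithmic radii, up to the factors \<open>exp x\<^sub>j\<close>).
  Convexity in two variables is enough for what follows. Moreover
  \<open>u(x + c) = u(x) + 2 (m + 1) c\<close>, \<open>u\<close> is symmetric in \<open>x\<^sub>0, \<dots>, x\<^sub>k\<close> and in \<open>x\<^sub>k\<^sub>+\<^sub>1, \<dots>, x\<^sub>m\<close>, and
  \<open>u \<le> (m + 1) ln (exp(2 x\<^sub>0) + \<dots> + exp(2 x\<^sub>m))\<close> since \<open>\<phi> \<le> 0\<close>.

  These properties give the key bound (\<open>lower_bound\<close> in locale \<open>torus_potential\<close>)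
  \<open>u(x) \<ge> 2 (m + 1) min(s, t)\<close>, where \<open>s\<close> and \<open>t\<close> are the means of the two blocks of variables. A
  convex function bounded above near \<open>-\<infinity>\<close> is increasing, so \<open>u\<close> increases in each variable. At a
  point where \<open>\<phi>\<close> is almost \<open>0\<close>, replacing all \<open>x\<^sub>j\<close> by their maximum \<open>M\<close> gives
  \<open>u(0) + 2 (m + 1) M \<ge> u(x) \<ge> 2 (m + 1) M - \<epsilon>\<close>, so \<open>u(0) \<ge> 0\<close>. Replacing the variables of a block
  by their mean decreases \<open>u\<close>, by symmetry and convexity; and replacing both means by the smaller
  one decreases it further, to \<open>u(0) + 2 (m + 1) min(s, t)\<close>.

  The volume element is \<open>(m + 1)\<^sup>m |z|\<^sup>-\<^sup>2\<^sup>(\<^sup>m\<^sup>+\<^sup>1\<^sup>)\<close> times Lebesgue measure in the chart \<open>z\<^sub>0 = 1\<close>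
  (\<open>volume_density_eq\<close>). For \<open>\<alpha> > 0\<close>, to which the general case reduces as \<open>\<phi> \<le> 0\<close>, the
  integrand is therefore bounded, up to a constant, by \<open>|z|\<^sup>-\<^sup>2\<^sup>(\<^sup>1\<^sup>-\<^sup>\<alpha>\<^sup>)\<^sup>(\<^sup>m\<^sup>+\<^sup>1\<^sup>)\<close> times the sum of
  \<open>\<Prod>\<^sub>j\<^sub>\<le>\<^sub>k |z\<^sub>j|\<^sup>-\<^sup>2\<^sup>a\<close> with \<open>a = \<alpha> (m + 1) / (k + 1)\<close> and of \<open>\<Prod>\<^sub>j\<^sub>>\<^sub>k |z\<^sub>j|\<^sup>-\<^sup>2\<^sup>b\<close> with
  \<open>b = \<alpha> (m + 1) / (m - k)\<close>. The hypothesis on \<open>\<alpha>\<close> says that \<open>a < 1\<close> and \<open>b < 1\<close>, which makes the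
  poles integrable; and \<open>(1 - \<alpha>) (m + 1)\<close> is large enough to be shared out among the variables so
  that each factor is integrable at infinity (\<open>nn_integral_prod_pole_weight\<close>).
\<close>


section \<open>Symmetric functions convex in pairs of variables\<close>

lemma convex_bdd_above_left_mono:
  fixes g :: "real \<Rightarrow> real"
  assumes conv: "convex_on UNIV g" and bdd: "\<And>t. t \<le> 0 \<Longrightarrow> g t \<le> B" and "s \<le> t"
  shows "g s \<le> g t"
proof (rule ccontr)
  assume "\<not> g s \<le> g t"
  then have gt: "g t < g s" and st: "s < t"
    using \<open>s \<le> t\<close> by (auto simp: less_le)
  (* convexity extends the descent from s to t linearly to the left, beyond B at the point p *)
  define L where "L = max 0 (max (s / (t - s)) ((B - g s) / (g s - g t) + 1))"
  define p where "p = s - L * (t - s)"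
  have L: "L \<ge> 0" "L \<ge> s / (t - s)" "L > (B - g s) / (g s - g t)"
    by (auto simp: L_def)
  have "p \<le> 0" using L(2) st by (simp add: p_def field_simps)
  have "B - g s < L * (g s - g t)" using L(3) gt by (simp add: field_simps)
  define \<mu> where "\<mu> = L / (1 + L)"
  have \<mu>: "0 \<le> \<mu>" "\<mu> \<le> 1" "\<mu> * (1 + L) = L" "(1 - \<mu>) * (1 + L) = 1"
    using L(1) by (auto simp: \<mu>_def field_simps)
  have "((1 - \<mu>) * p + \<mu> * t) * (1 + L) = ((1 - \<mu>) * (1 + L)) * p + (\<mu> * (1 + L)) * t"
    by (simp add: algebra_simps)
  also have "\<dots> = s * (1 + L)" unfolding \<mu> by (simp add: p_def algebra_simps)
  finally have "(1 - \<mu>) *\<^sub>R p + \<mu> *\<^sub>R t = s" using L(1) by simp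
  then have "g s \<le> (1 - \<mu>) * g p + \<mu> * g t"
    using convex_onD[OF conv \<mu>(1,2), of p t] by simp
  then have "g s * (1 + L) \<le> ((1 - \<mu>) * g p + \<mu> * g t) * (1 + L)"
    using L(1) by (intro mult_right_mono) auto
  also have "\<dots> = ((1 - \<mu>) * (1 + L)) * g p + (\<mu> * (1 + L)) * g t" by (simp add: algebra_simps)
  also have "\<dots> = g p + L * g t" unfolding \<mu> by simp
  finally have "g s * (1 + L) \<le> g p + L * g t" .
  with \<open>B - g s < L * (g s - g t)\<close> have "B < g p" by (simp add: algebra_simps)
  with bdd[OF \<open>p \<le> 0\<close>] show False by simp
qed


text \<open>
  A convex function taking the same value at \<open>0\<close> and \<open>c\<close> is at most that value in between.
\<close>

lemma convex_symmetric_le: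
  fixes g :: "real \<Rightarrow> real"
  assumes conv: "convex_on UNIV g" and sym: "g c = g 0" and "0 \<le> e" "e \<le> c"
  shows "g e \<le> g 0"
proof (cases "c = 0")
  case False
  then have "0 < c" using assms by simp
  then have "g ((1 - e / c) *\<^sub>R 0 + (e / c) *\<^sub>R c) \<le> (1 - e / c) * g 0 + (e / c) * g c"
    using assms by (intro convex_onD[OF conv]) auto
  then show ?thesis using \<open>0 < c\<close> by (simp add: sym algebra_simps)
qed (use assms in auto)

lemma exists_less_greater_avg:
  fixes x :: "nat \<Rightarrow> real"
  assumes "finite A" "sum x A = real (card A) * c" "j \<in> A" "x j \<noteq> c"
  shows "\<exists>i\<in>A. x i < c" "\<exists>i\<in>A. c < x i"
proof -
  have s: "(\<Sum>i\<in>A. x i - c) = 0" using assms by (simp add: sum_subtractf)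
  show "\<exists>i\<in>A. x i < c"
  proof (rule ccontr)
    assume "\<not> ?thesis"
    then have "\<forall>i\<in>A. x i - c = 0"
      using s assms(1) by (subst (asm) sum_nonneg_eq_0_iff) auto
    then show False using assms by auto
  qed
  show "\<exists>i\<in>A. c < x i"
  proof (rule ccontr)
    assume "\<not> ?thesis"
    moreover have "(\<Sum>i\<in>A. c - x i) = 0" using s by (simp add: sum_subtractf)
    ultimately have "\<forall>i\<in>A. c - x i = 0"
      using assms(1) by (subst (asm) sum_nonneg_eq_0_iff) auto
    then show False using assms by auto
  qed
qed


text \<open>
  Averaging decreases a function that is symmetric in the variables indexed by \<open>A\<close> and convex in the
  directions transferring mass from one of them to another. The induction is on the number of
  variables different from the mean \<open>c\<close>.
\<close>

lemma averaging_le: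
  fixes u :: "(nat \<Rightarrow> real) \<Rightarrow> real"
  assumes conv: "\<And>x i j. i \<in> A \<Longrightarrow> j \<in> A \<Longrightarrow> i \<noteq> j \<Longrightarrow>
      convex_on UNIV (\<lambda>t. u (x(i := x i + t, j := x j - t)))"
    and swap: "\<And>x i j. i \<in> A \<Longrightarrow> j \<in> A \<Longrightarrow> u (x(i := x j, j := x i)) = u x"
    and "finite A" "sum x A = real (card A) * c"
  shows "u (\<lambda>l. if l \<in> A then c else x l) \<le> u x"
  using assms(4)
proof (induction "card {l\<in>A. x l \<noteq> c}" arbitrary: x rule: less_induct)
  case less
  show ?case
  proof (cases "\<exists>l\<in>A. x l \<noteq> c")
    case False
    then have "(\<lambda>l. if l \<in> A then c else x l) = x" by auto
    then show ?thesis by simp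
  next
    case True
    then obtain i j where ij: "i \<in> A" "x i < c" "j \<in> A" "c < x j"
      using exists_less_greater_avg[OF \<open>finite A\<close> less.prems] by blast
    then have "i \<noteq> j" by auto
    (* transfer mass from x j to x i until one of the two reaches the mean *)
    define e where "e = min (c - x i) (x j - c)"
    define y where "y = x(i := x i + e, j := x j - e)"
    have "u y \<le> u x"
    proof -
      have "u (x(i := x i + e, j := x j - e)) \<le> u (x(i := x i + 0, j := x j - 0))"
      proof (rule convex_symmetric_le[OF conv[OF ij(1,3) \<open>i \<noteq> j\<close>], of x "x j - x i" e])
        show "u (x(i := x i + (x j - x i), j := x j - (x j - x i))) = u (x(i := x i + 0, j := x j - 0))"
          using swap[OF ij(1,3), of x] by simp
      qed (use ij in \<open>auto simp: e_def\<close>)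
      then show ?thesis by (simp add: y_def)
    qed
    have "{l\<in>A. y l \<noteq> c} \<subset> {l\<in>A. x l \<noteq> c}"
    proof
      show "{l\<in>A. y l \<noteq> c} \<subseteq> {l\<in>A. x l \<noteq> c}" using ij by (auto simp: y_def)
      have "y i = c \<or> y j = c" using \<open>i \<noteq> j\<close> by (auto simp: y_def e_def min_def)
      then show "{l\<in>A. y l \<noteq> c} \<noteq> {l\<in>A. x l \<noteq> c}" using ij by (smt (verit) mem_Collect_eq)
    qed
    then have "card {l\<in>A. y l \<noteq> c} < card {l\<in>A. x l \<noteq> c}"
      using \<open>finite A\<close> by (intro psubset_card_mono) auto
    moreover have "sum y A = real (card A) * c"
    proof -
      have "sum y A = sum x A" 
        using ij \<open>i \<noteq> j\<close> \<open>finite A\<close> unfolding y_def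
        by (simp add: sum.remove[of A i] sum.remove[of "A - {i}" j])
      then show ?thesis using less.prems by simp
    qed
    ultimately have "u (\<lambda>l. if l \<in> A then c else y l) \<le> u y" by (rule less.hyps)
    also have "(\<lambda>l. if l \<in> A then c else y l) = (\<lambda>l. if l \<in> A then c else x l)"
      using ij by (auto simp: y_def)
    finally show ?thesis using \<open>u y \<le> u x\<close> by simp
  qed
qed


text \<open>
  The properties of \<open>u(x) = \<phi> + (m + 1) ln |z|\<^sup>2\<close>, as a function of \<open>x\<^sub>j = ln |z\<^sub>j|\<close>, that the estimate
  depends on. Only the coordinates \<open>x\<^sub>0, \<dots>, x\<^sub>m\<close> matter (assumption \<open>cong\<close>); \<open>upper\<close> is the
  inequality \<open>\<phi> \<le> 0\<close>, and \<open>near\<close> says that \<open>\<phi>\<close> comes arbitrarily close to \<open>0\<close>.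
\<close>

locale torus_potential =
  fixes m k :: nat and u :: "(nat \<Rightarrow> real) \<Rightarrow> real"
  assumes m: "1 \<le> m" and km: "k < m"
    and cong: "(\<And>l. l \<le> m \<Longrightarrow> x l = y l) \<Longrightarrow> u x = u y"
    and shift: "u (\<lambda>l. x l + c) = u x + 2 * (real m + 1) * c"
    and swap: "i \<le> m \<Longrightarrow> j \<le> m \<Longrightarrow> (i \<le> k \<longleftrightarrow> j \<le> k) \<Longrightarrow> u (x(i := x j, j := x i)) = u x"
    and conv: "i \<le> m \<Longrightarrow> j \<le> m \<Longrightarrow> i \<noteq> j \<Longrightarrow>
      convex_on UNIV (\<lambda>t. u (x(i := x i + p * t, j := x j + q * t)))"
    and upper: "u x \<le> (real m + 1) * ln (\<Sum>l=0..m. exp (2 * x l))"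
    and near: "0 < e \<Longrightarrow> \<exists>x. (real m + 1) * ln (\<Sum>l=0..m. exp (2 * x l)) - e \<le> u x"
begin

lemma mono_coord:
  assumes "i \<le> m" "x i \<le> a"
  shows "u x \<le> u (x(i := a))"
proof -
  obtain j where j: "j \<le> m" "i \<noteq> j"
    using m assms by (metis le_zero_eq not_one_le_zero zero_le)
  define B where "B = (real m + 1) * ln (\<Sum>l=0..m. exp (2 * x l))"
  have c: "convex_on UNIV (\<lambda>t. u (x(i := x i + t)))"
    using conv[OF assms(1) j, of x 1 0] j(2) by (simp add: fun_upd_idem)
  have "u (x(i := x i + 0)) \<le> u (x(i := x i + (a - x i)))"
  proof (rule convex_bdd_above_left_mono[OF c])
    show "u (x(i := x i + t)) \<le> B" if "t \<le> 0" for t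
    proof -
      have "(\<Sum>l=0..m. exp (2 * (x(i := x i + t)) l)) \<le> (\<Sum>l=0..m. exp (2 * x l))"
        using that by (intro sum_mono) auto
      moreover have "0 < (\<Sum>l=0..m. exp (2 * (x(i := x i + t)) l))"
        by (intro sum_pos) auto
      ultimately have "(real m + 1) * ln (\<Sum>l=0..m. exp (2 * (x(i := x i + t)) l)) \<le> B"
        unfolding B_def by (intro mult_left_mono) auto
      then show ?thesis using upper[of "x(i := x i + t)"] by linarith
    qed
  qed (use assms in auto)
  then show ?thesis by simp
qed

lemma mono:
  assumes "\<And>l. l \<le> m \<Longrightarrow> x l \<le> y l"
  shows "u x \<le> u y"
proof -
  have "n \<le> Suc m \<Longrightarrow> u x \<le> u (\<lambda>l. if l < n then y l else x l)" for n
  proof (induction n)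
    case (Suc n)
    have "u (\<lambda>l. if l < n then y l else x l) \<le> u ((\<lambda>l. if l < n then y l else x l)(n := y n))"
      using Suc.prems assms by (intro mono_coord) auto
    also have "(\<lambda>l. if l < n then y l else x l)(n := y n) = (\<lambda>l. if l < Suc n then y l else x l)"
      by (auto simp: less_Suc_eq)
    finally show ?case using Suc by simp
  qed simp
  from this[of "Suc m"] show ?thesis
    using cong[of "\<lambda>l. if l < Suc m then y l else x l" y] by simp
qed

lemma const: "u (\<lambda>_. c) = u (\<lambda>_. 0) + 2 * (real m + 1) * c"
  using shift[of "\<lambda>_. 0" c] by simp

lemma zero_nonneg: "0 \<le> u (\<lambda>_. 0)"
proof (rule field_le_epsilon)
  fix e :: real assume "0 < e"
  then obtain x where x: "(real m + 1) * ln (\<Sum>l=0..m. exp (2 * x l)) - e \<le> u x"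
    using near by blast
  define M where "M = Max (x ` {0..m})"
  have "M \<in> x ` {0..m}" unfolding M_def by (rule Max_in) auto
  then obtain i where i: "i \<le> m" "x i = M" by auto
  have "u x \<le> u (\<lambda>_. M)" by (rule mono) (auto simp: M_def)
  also have "\<dots> = u (\<lambda>_. 0) + 2 * (real m + 1) * M" by (rule const)
  finally have 1: "u x \<le> u (\<lambda>_. 0) + 2 * (real m + 1) * M" .
  have "exp (2 * M) \<le> (\<Sum>l=0..m. exp (2 * x l))"
    using member_le_sum[of i "{0..m}" "\<lambda>l. exp (2 * x l)"] i by auto
  then have "ln (exp (2 * M)) \<le> ln (\<Sum>l=0..m. exp (2 * x l))"
    by (intro ln_mono) auto
  then have "(real m + 1) * (2 * M) \<le> (real m + 1) * ln (\<Sum>l=0..m. exp (2 * x l))"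
    by (intro mult_left_mono) auto
  with 1 x show "0 \<le> u (\<lambda>_. 0) + e" by (simp add: algebra_simps)
qed

proposition lower_bound:
  "2 * (real m + 1) * min (sum x {0..k} / (real k + 1)) (sum x {k+1..m} / (real m - real k)) \<le> u x"
proof -
  define s where "s = sum x {0..k} / (real k + 1)"
  define t where "t = sum x {k+1..m} / (real m - real k)"
  define y where "y = (\<lambda>l. if l \<in> {0..k} then s else x l)"
  have c: "convex_on UNIV (\<lambda>t. u (x(i := x i + t, j := x j - t)))" if "i \<le> m" "j \<le> m" "i \<noteq> j" for i j x
    using conv[OF that, of x 1 "-1"] by simp
  have "u y \<le> u x" unfolding y_def
    using km by (intro averaging_le c swap) (auto simp: s_def field_simps)
  moreover have "u (\<lambda>l. if l \<in> {k+1..m} then t else y l) \<le> u y"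
  proof (intro averaging_le c swap)
    have "sum y {k+1..m} = sum x {k+1..m}" by (intro sum.cong) (auto simp: y_def)
    then show "sum y {k+1..m} = real (card {k+1..m}) * t"
      using km by (simp add: t_def of_nat_diff)
  qed (use km in auto)
  moreover have "u (\<lambda>_. min s t) \<le> u (\<lambda>l. if l \<in> {k+1..m} then t else y l)"
    by (rule mono) (auto simp: y_def)
  ultimately have "u (\<lambda>_. min s t) \<le> u x" by linarith
  then show ?thesis using zero_nonneg const[of "min s t"] by (simp add: s_def t_def)
qed

end


section \<open>Rotation invariant functions in a chart\<close>

lemma chart_upd:
  assumes "z \<in> chart m l" "a \<in> chart_idx m l"
  shows "z(a := w) \<in> chart m l"
  using assms by (auto simp: chart_def chart_idx_def)

lemma continuous_on_upd:
  fixes F :: "'a::topological_space \<Rightarrow> nat \<Rightarrow> complex"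
  assumes F: "continuous_on S F" and g: "continuous_on S g"
  shows "continuous_on S (\<lambda>x. (F x)(a := g x))"
proof (rule continuous_on_coordinatewise_then_product)
  show "continuous_on S (\<lambda>x. ((F x)(a := g x)) i)" for i
    using g continuous_on_product_then_coordinatewise[OF F, of i] by (cases "i = a") auto
qed

lemma dir_deriv_cong_chart:
  assumes "z \<in> chart m l" "a \<in> chart_idx m l" "\<And>z. z \<in> chart m l \<Longrightarrow> F z = G z"
  shows "dir_deriv (a, c) F z = dir_deriv (a, c) G z"
  using assms by (simp add: dir_deriv_def chart_upd)

lemma DERIV_along_line:
  fixes h :: "(nat \<Rightarrow> complex) \<Rightarrow> real"
  assumes "dir_differentiable (a, c) h (z(a := z0 + of_real s * c))"
  shows "((\<lambda>t. h (z(a := z0 + of_real t * c))) has_real_derivative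
    dir_deriv (a, c) h (z(a := z0 + of_real s * c))) (at s)"
proof -
  have "((\<lambda>t. h (z(a := z0 + of_real s * c + of_real t * c))) has_real_derivative
    dir_deriv (a, c) h (z(a := z0 + of_real s * c))) (at 0)"
    using assms vector_derivative_works unfolding dir_differentiable_def dir_deriv_def
    by (fastforce simp: has_real_derivative_iff_has_vector_derivative)
  then have "((\<lambda>t. h (z(a := z0 + of_real (t + s) * c))) has_real_derivative
    dir_deriv (a, c) h (z(a := z0 + of_real s * c))) (at 0)"
    by (simp add: algebra_simps)
  then show ?thesis
    using DERIV_shift[of "\<lambda>t. h (z(a := z0 + of_real t * c))" _ 0 s] by simp
qed

lemma dir_deriv_eqI:
  fixes h :: "(nat \<Rightarrow> complex) \<Rightarrow> real"
  assumes "((\<lambda>t. h (z(a := z a + of_real t * c))) has_real_derivative D) (at 0)"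
  shows "dir_deriv (a, c) h z = D"
  using assms unfolding dir_deriv_def
  by (simp add: has_real_derivative_iff_has_vector_derivative vector_derivative_at)


text \<open>
  The chain rule along a curve that moves two coordinates through real values.
\<close>

lemma DERIV_two_coordinates:
  fixes h :: "(nat \<Rightarrow> complex) \<Rightarrow> real"
  assumes ab: "a \<noteq> b" "a \<in> chart_idx m l" "b \<in> chart_idx m l" and z: "z \<in> chart m l"
    and cont: "continuous_on (chart m l) (dir_deriv (b, 1) h)"
    and da: "\<And>z. z \<in> chart m l \<Longrightarrow> dir_differentiable (a, 1) h z"
    and db: "\<And>z. z \<in> chart m l \<Longrightarrow> dir_differentiable (b, 1) h z"
    and x: "(x has_real_derivative x') (at t)" and y: "(y has_real_derivative y') (at t)"
  defines "\<gamma> \<equiv> \<lambda>t. z(a := complex_of_real (x t), b := of_real (y t))"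
  shows "((\<lambda>t. h (\<gamma> t)) has_real_derivative
     x' * dir_deriv (a, 1) h (\<gamma> t) + y' * dir_deriv (b, 1) h (\<gamma> t)) (at t)"
proof -
  define P where "P = (\<lambda>x y :: real. z(a := complex_of_real x, b := of_real y))"
  have P: "P x y \<in> chart m l" for x y
    using z ab unfolding P_def by (intro chart_upd)
  have fx: "((\<lambda>x. h (P x y)) has_real_derivative dir_deriv (a, 1) h (P x y)) (at x)" for x y
    using DERIV_along_line[of a 1 h "z(b := of_real y)" 0 x] da[OF P[of x y]] ab(1)
    by (simp add: P_def fun_upd_twist)
  have fy: "((\<lambda>y. h (P x y)) has_real_derivative dir_deriv (b, 1) h (P x y)) (at y)" for x y
    using DERIV_along_line[of b 1 h "z(a := of_real x)" 0 y] db[OF P[of x y]]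
    by (simp add: P_def)
  have contP: "continuous_on UNIV (\<lambda>p. P (fst p) (snd p))"
    unfolding P_def by (intro continuous_on_upd continuous_intros)
  have "continuous_on UNIV (\<lambda>p. dir_deriv (b, 1) h (P (fst p) (snd p)))"
    by (rule continuous_on_compose2[OF cont contP]) (use P in auto)
  then have "continuous_on UNIV (\<lambda>p. blinfun_scaleR_left (dir_deriv (b, 1) h (P (fst p) (snd p))) :: real \<Rightarrow>\<^sub>L real)"
    by (rule bounded_linear.continuous_on[OF bounded_linear_blinfun_scaleR_left])
  then have c: "continuous (at (x t, y t) within UNIV \<times> UNIV)
      (\<lambda>(x, y). blinfun_scaleR_left (dir_deriv (b, 1) h (P x y)) :: real \<Rightarrow>\<^sub>L real)"
    by (simp add: continuous_on_eq_continuous_at case_prod_unfold)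
  have "((\<lambda>(x, y). h (P x y)) has_derivative
      (\<lambda>(tx, ty). dir_deriv (a, 1) h (P (x t) (y t)) * tx + blinfun_apply (blinfun_scaleR_left (dir_deriv (b, 1) h (P (x t) (y t)))) ty))
      (at (x t, y t) within UNIV \<times> UNIV)"
    using fx fy by (intro has_derivative_partialsI[OF _ _ c])
      (auto simp: has_field_derivative_def mult.commute[of _ "dir_deriv _ _ _"])
  then have "((\<lambda>(x, y). h (P x y)) has_derivative
      (\<lambda>(tx, ty). dir_deriv (a, 1) h (P (x t) (y t)) * tx + ty * dir_deriv (b, 1) h (P (x t) (y t)))) (at (x t, y t))"
    by simp
  moreover have "((\<lambda>t. (x t, y t)) has_derivative (\<lambda>s. (x' * s, y' * s))) (at t)"
    using x y by (intro has_derivative_Pair) (auto simp: has_field_derivative_def)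
  ultimately have "((\<lambda>(x, y). h (P x y)) \<circ> (\<lambda>t. (x t, y t)) has_derivative
      (\<lambda>(tx, ty). dir_deriv (a, 1) h (P (x t) (y t)) * tx + ty * dir_deriv (b, 1) h (P (x t) (y t))) \<circ> (\<lambda>s. (x' * s, y' * s))) (at t)"
    by (intro diff_chain_at)
  moreover have "(\<lambda>(x, y). h (P x y)) \<circ> (\<lambda>t. (x t, y t)) = (\<lambda>t. h (\<gamma> t))"
    by (simp add: fun_eq_iff P_def \<gamma>_def)
  moreover have "(\<lambda>(tx, ty). dir_deriv (a, 1) h (P (x t) (y t)) * tx + ty * dir_deriv (b, 1) h (P (x t) (y t))) \<circ> (\<lambda>s. (x' * s, y' * s))
      = (*) (x' * dir_deriv (a, 1) h (\<gamma> t) + y' * dir_deriv (b, 1) h (\<gamma> t))"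
    by (simp add: fun_eq_iff P_def \<gamma>_def algebra_simps)
  ultimately show ?thesis by (simp add: has_field_derivative_def)
qed

lemma smooth_chartD:
  assumes "smooth_chart m l f" "set ds \<subseteq> real_dirs m l"
  shows "continuous_on (chart m l) (foldr dir_deriv ds f)"
    and "d \<in> real_dirs m l \<Longrightarrow> z \<in> chart m l \<Longrightarrow> dir_differentiable d (foldr dir_deriv ds f) z"
proof -
  have ds: "ds \<in> lists (real_dirs m l)" using assms(2) by (simp only: in_lists_conv_set) blast
  show "continuous_on (chart m l) (foldr dir_deriv ds f)"
    using assms(1) ds unfolding smooth_chart_def by blast
  show "d \<in> real_dirs m l \<Longrightarrow> z \<in> chart m l \<Longrightarrow> dir_differentiable d (foldr dir_deriv ds f) z"
    using assms(1) ds unfolding smooth_chart_def by blast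
qed


text \<open>
  A smooth function in the chart \<open>z\<^sub>l = 1\<close> that depends on the moduli of the coordinates only.
\<close>

locale torus_symmetric_chart =
  fixes m l :: nat and f :: "(nat \<Rightarrow> complex) \<Rightarrow> real"
  assumes smooth: "smooth_chart m l f"
    and rot: "\<And>z a w. z \<in> chart m l \<Longrightarrow> a \<in> chart_idx m l \<Longrightarrow> cmod w = cmod (z a) \<Longrightarrow> f (z(a := w)) = f z"
begin

lemma diff0:
  "a \<in> chart_idx m l \<Longrightarrow> c \<in> {1, \<i>} \<Longrightarrow> z \<in> chart m l \<Longrightarrow> dir_differentiable (a, c) f z"
  using smooth_chartD(2)[OF smooth, of "[]" "(a, c)" z] by (auto simp: real_dirs_def)

lemma diff1:
  "a \<in> chart_idx m l \<Longrightarrow> c \<in> {1, \<i>} \<Longrightarrow> b \<in> chart_idx m l \<Longrightarrow> e \<in> {1, \<i>} \<Longrightarrow> z \<in> chart m l \<Longrightarrow>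
    dir_differentiable (a, c) (dir_deriv (b, e) f) z"
  using smooth_chartD(2)[OF smooth, of "[(b, e)]" "(a, c)" z] by (auto simp: real_dirs_def)

lemma cont1:
  "a \<in> chart_idx m l \<Longrightarrow> continuous_on (chart m l) (dir_deriv (a, 1) f)"
  using smooth_chartD(1)[OF smooth, of "[(a, 1)]"] by (auto simp: real_dirs_def)

lemma cont2:
  "a \<in> chart_idx m l \<Longrightarrow> b \<in> chart_idx m l \<Longrightarrow>
    continuous_on (chart m l) (dir_deriv (a, 1) (dir_deriv (b, 1) f))"
  using smooth_chartD(1)[OF smooth, of "[(a, 1), (b, 1)]"] by (auto simp: real_dirs_def)


text \<open>
  By invariance \<open>f\<close> takes the same value at \<open>z\<^sub>a = r + \<i> y\<close> and at \<open>z\<^sub>a = sqrt (r\<^sup>2 + y\<^sup>2)\<close>, so its derivatives in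
  imaginary directions are expressed by derivatives in real ones.
\<close>

lemma dir_deriv_imaginary:
  assumes z: "z \<in> chart m l" and a: "a \<in> chart_idx m l" and r: "0 < r"
  shows "dir_deriv (a, \<i>) f (z(a := of_real r + of_real y * \<i>))
    = y * (dir_deriv (a, 1) f (z(a := of_real (sqrt (r\<^sup>2 + y\<^sup>2)))) / sqrt (r\<^sup>2 + y\<^sup>2))"
proof -
  have "((\<lambda>t. f (z(a := of_real r + of_real t * \<i>))) has_real_derivative
      dir_deriv (a, \<i>) f (z(a := of_real r + of_real y * \<i>))) (at y)"
    using z a by (intro DERIV_along_line diff0 chart_upd) auto
  moreover have "f (z(a := of_real r + of_real t * \<i>)) = f (z(a := of_real (sqrt (r\<^sup>2 + t\<^sup>2))))" for t
    using rot[OF chart_upd[OF z a] a, of "of_real r + of_real t * \<i>" "of_real (sqrt (r\<^sup>2 + t\<^sup>2))"]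
    by (simp add: cmod_def)
  ultimately have 1: "((\<lambda>t. f (z(a := of_real (sqrt (r\<^sup>2 + t\<^sup>2))))) has_real_derivative
      dir_deriv (a, \<i>) f (z(a := of_real r + of_real y * \<i>))) (at y)"
    by simp
  have pos: "0 < r\<^sup>2 + y\<^sup>2" using r by (simp add: add_pos_nonneg)
  have "((\<lambda>s. f (z(a := of_real s))) has_real_derivative
      dir_deriv (a, 1) f (z(a := of_real s))) (at s)" for s
    using DERIV_along_line[of a 1 f z 0 s] diff0[OF a, of 1, OF _ chart_upd[OF z a]] by simp
  moreover have "((\<lambda>t. sqrt (r\<^sup>2 + t\<^sup>2)) has_real_derivative y / sqrt (r\<^sup>2 + y\<^sup>2)) (at y)"
    using pos by (auto intro!: derivative_eq_intros simp: field_simps)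
  ultimately have 2: "((\<lambda>t. f (z(a := of_real (sqrt (r\<^sup>2 + t\<^sup>2))))) has_real_derivative
      dir_deriv (a, 1) f (z(a := of_real (sqrt (r\<^sup>2 + y\<^sup>2)))) * (y / sqrt (r\<^sup>2 + y\<^sup>2))) (at y)"
    by (rule DERIV_chain2)
  show ?thesis using DERIV_unique[OF 1 2] by simp
qed

lemma dir_deriv_imaginary_twice:
  assumes z: "z \<in> chart m l" and a: "a \<in> chart_idx m l" and r: "z a = of_real r" "0 < r"
  shows "dir_deriv (a, \<i>) (dir_deriv (a, \<i>) f) z = dir_deriv (a, 1) f z / r"
proof (rule dir_deriv_eqI)
  define M where "M y = dir_deriv (a, 1) f (z(a := of_real (sqrt (r\<^sup>2 + y\<^sup>2)))) / sqrt (r\<^sup>2 + y\<^sup>2)" for y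
  have "continuous_on UNIV M"
    unfolding M_def
  proof (intro continuous_on_divide continuous_intros)
    have "continuous_on UNIV (\<lambda>y. z(a := complex_of_real (sqrt (r\<^sup>2 + y\<^sup>2))))"
      by (intro continuous_on_upd continuous_intros)
    then show "continuous_on UNIV (\<lambda>y. dir_deriv (a, 1) f (z(a := of_real (sqrt (r\<^sup>2 + y\<^sup>2)))))"
      by (rule continuous_on_compose2[OF cont1[OF a]]) (use chart_upd[OF z a] in auto)
  qed (use r in \<open>auto simp: add_nonneg_eq_0_iff\<close>)
  then have "isCont M 0" by (simp add: continuous_on_eq_continuous_at)
  moreover have "M 0 = dir_deriv (a, 1) f z / r" using r by (simp add: M_def fun_upd_idem)
  ultimately have "((\<lambda>y. y * M y) has_real_derivative dir_deriv (a, 1) f z / r) (at 0)"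
    unfolding CARAT_DERIV by (intro exI[of _ M]) auto
  then show "((\<lambda>t. dir_deriv (a, \<i>) f (z(a := z a + of_real t * \<i>))) has_real_derivative
      dir_deriv (a, 1) f z / r) (at 0)"
    unfolding r M_def by (subst dir_deriv_imaginary[OF z a r(2)])
qed

lemma dir_deriv_imaginary_mixed:
  assumes z: "z \<in> chart m l" and ab: "a \<in> chart_idx m l" "b \<in> chart_idx m l" "a \<noteq> b"
    and r: "z b = of_real r" "0 < r"
  shows "dir_deriv (a, \<i>) (dir_deriv (b, \<i>) f) z = 0"
proof (rule dir_deriv_eqI)
  have "dir_deriv (b, \<i>) f w = 0" if "w \<in> chart m l" "w b = of_real r" for w
    using dir_deriv_imaginary[OF that(1) ab(2) r(2), of 0] that(2) by (simp add: fun_upd_idem)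
  then have "dir_deriv (b, \<i>) f (z(a := w)) = 0" for w
    using chart_upd[OF z ab(1)] ab r by auto
  then show "((\<lambda>t. dir_deriv (b, \<i>) f (z(a := z a + of_real t * \<i>))) has_real_derivative 0) (at 0)"
    by simp
qed

lemma Re_ddbar:
  assumes z: "z \<in> chart m l" and a: "a \<in> chart_idx m l" and b: "b \<in> chart_idx m l"
  shows "Re (ddbar a b f z)
    = (dir_deriv (a, 1) (dir_deriv (b, 1) f) z + dir_deriv (a, \<i>) (dir_deriv (b, \<i>) f) z) / 4"
proof -
  have *: "dir_deriv (b, c) (\<lambda>z. complex_of_real (f z)) w = of_real (dir_deriv (b, c) f w)"
    if "w \<in> chart m l" "c \<in> {1, \<i>}" for w c
  proof -
    have "((\<lambda>t. f (w(b := w b + of_real t * c))) has_real_derivative dir_deriv (b, c) f w) (at 0)"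
      using DERIV_along_line[of b c f w "w b" 0] diff0[OF b that(2,1)] by simp
    then show ?thesis
      unfolding dir_deriv_def[of _ "\<lambda>z. complex_of_real (f z)"]
      by (intro vector_derivative_at) (auto intro!: has_vector_derivative_of_real)
  qed
  have **: "dir_deriv (a, c) (dzbar b (\<lambda>z. complex_of_real (f z))) z =
     (of_real (dir_deriv (a, c) (dir_deriv (b, 1) f) z)
      + \<i> * of_real (dir_deriv (a, c) (dir_deriv (b, \<i>) f) z)) / 2" if "c \<in> {1, \<i>}" for c
  proof -
    have "dir_deriv (a, c) (dzbar b (\<lambda>z. complex_of_real (f z))) z =
      dir_deriv (a, c) (\<lambda>z. (of_real (dir_deriv (b, 1) f z) + \<i> * of_real (dir_deriv (b, \<i>) f z)) / 2) z"
      using z a by (rule dir_deriv_cong_chart) (simp add: dzbar_def *)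
    also have "\<dots> = (of_real (dir_deriv (a, c) (dir_deriv (b, 1) f) z)
      + \<i> * of_real (dir_deriv (a, c) (dir_deriv (b, \<i>) f) z)) / 2"
      unfolding dir_deriv_def[of _ "\<lambda>z. (_ z + _ z) / 2"]
    proof (rule vector_derivative_at, unfold fst_conv snd_conv)
      have "((\<lambda>t. dir_deriv (b, e) f (z(a := z a + of_real t * c))) has_real_derivative dir_deriv (a, c) (dir_deriv (b, e) f) z) (at 0)"
        if "e \<in> {1, \<i>}" for e
        using DERIV_along_line[of a c "dir_deriv (b, e) f" z "z a" 0] diff1[OF a \<open>c \<in> _\<close> b that z] by simp
      then have *: "((\<lambda>t. complex_of_real (dir_deriv (b, e) f (z(a := z a + of_real t * c)))) has_vector_derivative of_real (dir_deriv (a, c) (dir_deriv (b, e) f) z)) (at 0)"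
        if "e \<in> {1, \<i>}" for e
        using that by (intro has_vector_derivative_of_real) auto
      show "((\<lambda>t. (complex_of_real (dir_deriv (b, 1) f (z(a := z a + of_real t * c)))
          + \<i> * of_real (dir_deriv (b, \<i>) f (z(a := z a + of_real t * c)))) / 2) has_vector_derivative
          (of_real (dir_deriv (a, c) (dir_deriv (b, 1) f) z)
      + \<i> * of_real (dir_deriv (a, c) (dir_deriv (b, \<i>) f) z)) / 2) (at 0)"
        by (intro has_vector_derivative_divide has_vector_derivative_add has_vector_derivative_mult_right *) auto
    qed
    finally show ?thesis .
  qed
  show ?thesis
    unfolding ddbar_def dz_def by (simp add: **)
qed

end


text \<open>
  The squared norm of the homogeneous coordinates, in any chart.
\<close>

definition sqnorm :: "nat \<Rightarrow> (nat \<Rightarrow> complex) \<Rightarrow> real" where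
  "sqnorm m z = (\<Sum>j=0..m. (cmod (z j))\<^sup>2)"

lemma sqnorm_upd:
  assumes "a \<le> m"
  shows "sqnorm m (z(a := w)) = sqnorm m z - (cmod (z a))\<^sup>2 + (cmod w)\<^sup>2"
  using assms by (simp add: sqnorm_def sum.remove[of "{0..m}" a])

lemma sqnorm_chart_ge_1:
  assumes "z \<in> chart m l" "l \<le> m"
  shows "1 \<le> sqnorm m z"
  using assms member_le_sum[of l "{0..m}" "\<lambda>j. (cmod (z j))\<^sup>2"]
  by (simp add: sqnorm_def chart_def)

lemma DERIV_sqnorm:
  assumes "a \<le> m"
  shows "((\<lambda>t. sqnorm m (z(a := z a + of_real t * c))) has_real_derivative 2 * Re (z a * cnj c)) (at 0)"
  unfolding sqnorm_upd[OF assms] cmod_power2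
  by (auto intro!: derivative_eq_intros)

lemma dzbar_ln_sqnorm:
  assumes z: "z \<in> chart m l" and l: "l \<le> m" and b: "b \<le> m"
  shows "dzbar b (\<lambda>z. complex_of_real (ln (sqnorm m z))) z = z b / of_real (sqnorm m z)"
proof -
  have pos: "0 < sqnorm m z" using sqnorm_chart_ge_1[OF z l] by simp
  have "dir_deriv (b, c) (\<lambda>z. complex_of_real (ln (sqnorm m z))) z = of_real (2 * Re (z b * cnj c) / sqnorm m z)" for c
  proof -
    have "((\<lambda>t. ln (sqnorm m (z(b := z b + of_real t * c)))) has_real_derivative
        2 * Re (z b * cnj c) / sqnorm m z) (at 0)"
    proof (rule DERIV_cong)
      show "((\<lambda>t. ln (sqnorm m (z(b := z b + of_real t * c)))) has_real_derivative
          inverse (sqnorm m (z(b := z b + of_real 0 * c))) * (2 * Re (z b * cnj c))) (at 0)"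
        by (rule DERIV_chain2[OF DERIV_ln DERIV_sqnorm[OF b]]) (simp add: fun_upd_idem pos)
    qed (simp add: fun_upd_idem divide_inverse)
    then show ?thesis
      unfolding dir_deriv_def fst_conv snd_conv
      by (intro vector_derivative_at has_vector_derivative_of_real)
  qed
  then show ?thesis by (simp add: dzbar_def complex_eq_iff)
qed

lemma ddbar_ln_sqnorm:
  assumes z: "z \<in> chart m l" and l: "l \<le> m" and a: "a \<in> chart_idx m l" and b: "b \<in> chart_idx m l"
  shows "ddbar a b (\<lambda>z. ln (sqnorm m z)) z
    = (if a = b then 1 else 0) / of_real (sqnorm m z) - z b * cnj (z a) / (of_real (sqnorm m z))\<^sup>2"
proof -
  have ab: "a \<le> m" "b \<le> m" using a b by (auto simp: chart_idx_def)
  have pos: "0 < sqnorm m z" using sqnorm_chart_ge_1[OF z l] by simp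
  define v where "v = 1 / (sqnorm m z)\<^sup>2"
  have *: "dir_deriv (a, c) (dzbar b (\<lambda>z. complex_of_real (ln (sqnorm m z)))) z =
      of_real (1 / sqnorm m z) * (if a = b then c else 0) - of_real (2 * Re (z a * cnj c) * v) * z b" for c
  proof -
    have "dir_deriv (a, c) (dzbar b (\<lambda>z. complex_of_real (ln (sqnorm m z)))) z
        = dir_deriv (a, c) (\<lambda>z. inverse (sqnorm m z) *\<^sub>R z b) z"
      using z a by (rule dir_deriv_cong_chart)
        (simp add: dzbar_ln_sqnorm l ab scaleR_conv_of_real divide_inverse mult.commute)
    also have "\<dots> = inverse (sqnorm m z) *\<^sub>R (if a = b then c else 0)
        + (- (2 * Re (z a * cnj c) / (sqnorm m z)\<^sup>2)) *\<^sub>R z b"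
      unfolding dir_deriv_def
    proof (rule vector_derivative_at, unfold fst_conv snd_conv)
      have 1: "((\<lambda>t. inverse (sqnorm m (z(a := z a + of_real t * c)))) has_real_derivative
          - (2 * Re (z a * cnj c) / (sqnorm m z)\<^sup>2)) (at 0)"
        using DERIV_inverse_fun[OF DERIV_sqnorm[OF ab(1), of z c]] pos
        by (simp add: fun_upd_idem divide_inverse power2_eq_square mult_ac)
      have 2: "((\<lambda>t. (z(a := z a + of_real t * c)) b) has_vector_derivative (if a = b then c else 0)) (at 0)"
      proof -
        have "((\<lambda>t. z a + of_real t * c) has_vector_derivative (0 + of_real 1 * c)) (at 0)"
          by (intro has_vector_derivative_add has_vector_derivative_const
              has_vector_derivative_mult_left has_vector_derivative_of_real DERIV_ident)
        then show ?thesis by (cases "a = b") simp_all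
      qed
      show "((\<lambda>t. inverse (sqnorm m (z(a := z a + of_real t * c))) *\<^sub>R (z(a := z a + of_real t * c)) b) has_vector_derivative
          inverse (sqnorm m z) *\<^sub>R (if a = b then c else 0)
        + (- (2 * Re (z a * cnj c) / (sqnorm m z)\<^sup>2)) *\<^sub>R z b) (at 0)"
        using has_vector_derivative_scaleR[OF 1 2] by (simp add: fun_upd_idem)
    qed
    finally show ?thesis by (simp add: scaleR_conv_of_real v_def divide_inverse)
  qed
  define u where "u = 1 / sqnorm m z"
  have "ddbar a b (\<lambda>z. ln (sqnorm m z)) z = of_real u * (if a = b then 1 else 0) - of_real v * (z b * cnj (z a))"
    unfolding ddbar_def dz_def * u_def[symmetric]
    by (cases "a = b") (simp_all add: complex_eq_iff field_simps)
  then show ?thesis by (simp add: u_def v_def)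
qed

lemma g_comp_eq:
  assumes "z \<in> chart m l" "l \<le> m" "a \<in> chart_idx m l" "b \<in> chart_idx m l"
  shows "g_comp m a b z = of_nat (m + 1) * ((if a = b then 1 else 0) / of_real (sqnorm m z)
      - z b * cnj (z a) / (of_real (sqnorm m z))\<^sup>2)"
  by (simp only: g_comp_def sqnorm_def[symmetric] ddbar_ln_sqnorm[OF assms])

lemma pos_def_hermitian_two:
  assumes H: "pos_def_hermitian I H" "finite I" and ij: "i \<in> I" "j \<in> I" "i \<noteq> j"
  shows "0 \<le> v\<^sup>2 * Re (H i i) + v * w * Re (H i j) + v * w * Re (H j i) + w\<^sup>2 * Re (H j j)"
proof (cases "v = 0 \<and> w = 0")
  case False
  define V :: "nat \<Rightarrow> complex" where "V = (\<lambda>a. if a = i then of_real v else if a = j then of_real w else 0)"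
  have "\<exists>a\<in>I. V a \<noteq> 0" using False ij by (auto simp: V_def)
  then have "0 < Re (\<Sum>a\<in>I. \<Sum>b\<in>I. H a b * V a * cnj (V b))"
    using H(1) unfolding pos_def_hermitian_def by blast
  also have "(\<Sum>a\<in>I. \<Sum>b\<in>I. H a b * V a * cnj (V b)) = (\<Sum>a\<in>{i, j}. \<Sum>b\<in>{i, j}. H a b * V a * cnj (V b))"
  proof -
    have "(\<Sum>b\<in>I. H a b * V a * cnj (V b)) = (\<Sum>b\<in>{i, j}. H a b * V a * cnj (V b))" for a
      by (rule sum.mono_neutral_right) (use H(2) ij in \<open>auto simp: V_def\<close>)
    moreover have "(\<Sum>a\<in>I. \<Sum>b\<in>{i, j}. H a b * V a * cnj (V b)) = (\<Sum>a\<in>{i, j}. \<Sum>b\<in>{i, j}. H a b * V a * cnj (V b))"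
      by (rule sum.mono_neutral_right) (use H(2) ij in \<open>auto simp: V_def\<close>)
    ultimately show ?thesis by simp
  qed
  also have "Re \<dots> = v\<^sup>2 * Re (H i i) + v * w * Re (H i j) + v * w * Re (H j i) + w\<^sup>2 * Re (H j j)"
    using ij by (simp add: V_def power2_eq_square mult_ac)
  finally show ?thesis by simp
qed simp


text \<open>
  The second derivative of the potential in the logarithmic radii \<open>x\<close> and \<open>y\<close>, in the direction
  \<open>(p, q)\<close>, is four times the value of the positive definite Hermitian form
  \<open>g\<^sub>a\<^sub>b + \<partial>\<^sub>a\<^sub>b f\<close> at the real vector with components \<open>p exp x\<close> and \<open>q exp y\<close>.
\<close>

lemma (in torus_symmetric_chart) convex_along_log_radii:
  fixes x y p q :: real
  assumes l: "l \<le> m" and ij: "i \<noteq> j" "i \<in> chart_idx m l" "j \<in> chart_idx m l" and z: "z \<in> chart m l"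
    and pd: "\<And>z. z \<in> chart m l \<Longrightarrow>
      pos_def_hermitian (chart_idx m l) (\<lambda>a b. g_comp m a b z + ddbar a b f z)"
  defines "\<gamma> \<equiv> \<lambda>t. z(i := complex_of_real (exp (x + p * t)), j := of_real (exp (y + q * t)))"
  shows "convex_on UNIV (\<lambda>t. f (\<gamma> t) + (real m + 1) * ln (sqnorm m (\<gamma> t)))"
proof -
  define r s where "r t = exp (x + p * t)" and "s t = exp (y + q * t)" for t
  have dr: "(r has_real_derivative p * r t) (at t)" and ds: "(s has_real_derivative q * s t) (at t)" for t
    unfolding r_def s_def by (auto intro!: derivative_eq_intros)
  have pos: "0 < r t" "0 < s t" for t by (auto simp: r_def s_def)
  have \<gamma>: "\<gamma> = (\<lambda>t. z(i := complex_of_real (r t), j := of_real (s t)))"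
    by (simp add: \<gamma>_def r_def s_def)
  have g: "\<gamma> t \<in> chart m l" "\<gamma> t i = of_real (r t)" "\<gamma> t j = of_real (s t)" for t
    using chart_upd z ij by (auto simp: \<gamma>)
  let ?D = "\<lambda>a t. dir_deriv (a, 1) f (\<gamma> t)"
  let ?DD = "\<lambda>a b t. dir_deriv (a, 1) (dir_deriv (b, 1) f) (\<gamma> t)"
  have d1: "((\<lambda>t. f (\<gamma> t)) has_real_derivative p * r t * ?D i t + q * s t * ?D j t) (at t)" for t
    unfolding \<gamma> by (rule DERIV_two_coordinates[OF ij z cont1 diff0 diff0 dr ds]) (use ij in auto)
  have d2: "((\<lambda>t. ?D a t) has_real_derivative p * r t * ?DD i a t + q * s t * ?DD j a t) (at t)"
    if "a \<in> chart_idx m l" for a t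
    unfolding \<gamma> by (rule DERIV_two_coordinates[OF ij z cont2 diff1 diff1 dr ds]) (use ij that in auto)
  define A where "A = sqnorm m z - (cmod (z i))\<^sup>2 - (cmod (z j))\<^sup>2"
  define N where "N t = A + (r t)\<^sup>2 + (s t)\<^sup>2" for t
  have N: "sqnorm m (\<gamma> t) = N t" for t
    using ij by (simp add: \<gamma> sqnorm_upd chart_idx_def A_def N_def)
  have Npos: "0 < N t" for t
    using sqnorm_chart_ge_1[OF g(1)[of t] l] by (simp add: N)
  have dN: "(N has_real_derivative 2 * p * (r t)\<^sup>2 + 2 * q * (s t)\<^sup>2) (at t)" for t
    unfolding N_def by (auto intro!: derivative_eq_intros dr ds simp: power2_eq_square)
  define F1 where "F1 t = p * r t * ?D i t + q * s t * ?D j t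
      + (real m + 1) * ((2 * p * (r t)\<^sup>2 + 2 * q * (s t)\<^sup>2) / N t)" for t
  define F2 where "F2 t = p * (p * r t) * ?D i t + p * r t * (p * r t * ?DD i i t + q * s t * ?DD j i t)
      + (q * (q * s t) * ?D j t + q * s t * (p * r t * ?DD i j t + q * s t * ?DD j j t))
      + (real m + 1) * ((4 * p\<^sup>2 * (r t)\<^sup>2 + 4 * q\<^sup>2 * (s t)\<^sup>2) / N t
          - (2 * p * (r t)\<^sup>2 + 2 * q * (s t)\<^sup>2)\<^sup>2 / (N t)\<^sup>2)" for t
  show ?thesis
  proof (rule f''_ge0_imp_convex[where f' = F1 and f'' = F2])
    show "((\<lambda>t. f (\<gamma> t) + (real m + 1) * ln (sqnorm m (\<gamma> t))) has_real_derivative F1 t) (at t)" for t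
      unfolding N F1_def using Npos[of t]
      by (auto intro!: derivative_eq_intros d1 dN)
    show "(F1 has_real_derivative F2 t) (at t)" for t
      unfolding F1_def F2_def using Npos[of t] ij
      by (auto intro!: derivative_eq_intros dr ds d2 dN simp: field_simps power2_eq_square)
    show "0 \<le> F2 t" for t
    proof -
      let ?H = "\<lambda>a b. g_comp m a b (\<gamma> t) + ddbar a b f (\<gamma> t)"
      have ne: "r t \<noteq> 0" "s t \<noteq> 0" "N t \<noteq> 0" using pos[of t] Npos[of t] by auto
      have "0 \<le> (p * r t)\<^sup>2 * Re (?H i i) + (p * r t) * (q * s t) * Re (?H i j)
          + (p * r t) * (q * s t) * Re (?H j i) + (q * s t)\<^sup>2 * Re (?H j j)"
        by (rule pos_def_hermitian_two[OF pd[OF g(1)]]) (use ij in \<open>auto simp: chart_idx_def\<close>)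
      moreover have "Re (?H i i) = (real m + 1) * (1 / N t - (r t)\<^sup>2 / (N t)\<^sup>2) + (?DD i i t + ?D i t / r t) / 4"
        using ij l g(2) pos
        by (simp add: g_comp_eq[OF g(1)] N Re_ddbar[OF g(1)] dir_deriv_imaginary_twice[OF g(1) _ g(2)] power2_eq_square Re_divide)
      moreover have "Re (?H j j) = (real m + 1) * (1 / N t - (s t)\<^sup>2 / (N t)\<^sup>2) + (?DD j j t + ?D j t / s t) / 4"
        using ij l g(3) pos
        by (simp add: g_comp_eq[OF g(1)] N Re_ddbar[OF g(1)] dir_deriv_imaginary_twice[OF g(1) _ g(3)] power2_eq_square Re_divide)
      moreover have "Re (?H i j) = (real m + 1) * (- (r t * s t) / (N t)\<^sup>2) + ?DD i j t / 4"
        using ij l g(2,3) pos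
        by (simp add: g_comp_eq[OF g(1)] N Re_ddbar[OF g(1)] dir_deriv_imaginary_mixed[OF g(1) _ _ _ g(3)] power2_eq_square Re_divide)
      moreover have "Re (?H j i) = (real m + 1) * (- (r t * s t) / (N t)\<^sup>2) + ?DD j i t / 4"
        using ij l g(2,3) pos
        by (simp add: g_comp_eq[OF g(1)] N Re_ddbar[OF g(1)] dir_deriv_imaginary_mixed[OF g(1) _ _ _ g(2)] power2_eq_square Re_divide)
      ultimately have "0 \<le> 4 * ((p * r t)\<^sup>2 * ((real m + 1) * (1 / N t - (r t)\<^sup>2 / (N t)\<^sup>2) + (?DD i i t + ?D i t / r t) / 4)
          + (p * r t) * (q * s t) * ((real m + 1) * (- (r t * s t) / (N t)\<^sup>2) + ?DD i j t / 4)
          + (p * r t) * (q * s t) * ((real m + 1) * (- (r t * s t) / (N t)\<^sup>2) + ?DD j i t / 4)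
          + (q * s t)\<^sup>2 * ((real m + 1) * (1 / N t - (s t)\<^sup>2 / (N t)\<^sup>2) + (?DD j j t + ?D j t / s t) / 4))"
        by simp
      also have "\<dots> = F2 t"
        unfolding F2_def using ne by (simp add: field_simps power2_eq_square)
      finally show ?thesis .
    qed
  qed simp
qed


section \<open>Integrability of poles\<close>


text \<open>
  One half of the transformation formula; it needs no measurability of the integrand \<open>f\<close>.
\<close>

lemma nn_integral_distr_le:
  assumes T: "T \<in> measurable M N"
  shows "(\<integral>\<^sup>+ x. f x \<partial>distr M N T) \<le> (\<integral>\<^sup>+ x. f (T x) \<partial>M)"
proof -
  have "integral\<^sup>S (distr M N T) g \<le> (\<integral>\<^sup>+ x. f (T x) \<partial>M)"
    if g: "simple_function (distr M N T) g" "g \<le> f" for g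
  proof -
    have "integral\<^sup>S (distr M N T) g = (\<integral>\<^sup>+ x. g x \<partial>distr M N T)"
      using g by (simp add: nn_integral_eq_simple_integral)
    also have "\<dots> = (\<integral>\<^sup>+ x. g (T x) \<partial>M)"
      using g by (intro nn_integral_distr T borel_measurable_simple_function)
    also have "\<dots> \<le> (\<integral>\<^sup>+ x. f (T x) \<partial>M)"
      using g by (intro nn_integral_mono) (auto simp: le_fun_def)
    finally show ?thesis .
  qed
  then show ?thesis unfolding nn_integral_def by (intro SUP_least) auto
qed

lemma inverse_ennreal_antimono:
  assumes "x \<le> y" shows "inverse (ennreal y) \<le> inverse (ennreal x)"
proof (cases "0 < x")
  case True
  then show ?thesis using assms by (auto simp: inverse_ennreal intro!: ennreal_leI le_imp_inverse_le)
qed (simp add: ennreal_neg)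


text \<open>
  The weight \<open>|x|\<^sup>-\<^sup>a (1 + |x|\<^sup>2)\<^sup>-\<^sup>e\<^sup>/\<^sup>2\<close>, with a pole of order \<open>a\<close> at the origin and decay of
  order \<open>a + e\<close> at infinity. Its value at the origin is \<open>\<infinity>\<close> for every \<open>a\<close>, as \<open>0 powr a = 0\<close> (also for
  \<open>a = 0\<close>); bounds by products of such weights thus hold trivially where a variable vanishes.
\<close>

definition pole_weight :: "real \<Rightarrow> real \<Rightarrow> 'a::real_normed_vector \<Rightarrow> ennreal" where
  "pole_weight a e x = inverse (ennreal (norm x powr a)) * ennreal ((1 + (norm x)\<^sup>2) powr (- e / 2))"

lemma measurable_pole_weight [measurable]:
  "pole_weight a e \<in> borel_measurable (borel :: 'a::euclidean_space measure)"
  unfolding pole_weight_def by measurable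

lemma one_plus_square_powr_le:
  fixes x :: real
  assumes "1 \<le> x" "0 \<le> e"
  shows "(1 + x\<^sup>2) powr (- e / 2) \<le> x powr (- e)"
proof -
  have "x powr (- e) = (x\<^sup>2) powr (- e / 2)"
    using assms by (simp add: powr_powr flip: powr_numeral)
  moreover have "(1 + x\<^sup>2) powr (- e / 2) \<le> (x\<^sup>2) powr (- e / 2)"
    using assms by (intro powr_mono2') auto
  ultimately show ?thesis by simp
qed

lemma nn_integral_pole_weight_real:
  assumes "0 \<le> a" "a < 1" "1 < a + e" 
  shows "(\<integral>\<^sup>+ x. pole_weight a e (x::real) \<partial>lborel) < \<infinity>"
proof -
  define h :: "real \<Rightarrow> ennreal" where
    "h x = ennreal (x powr (- a)) * indicator {0..1} x + ennreal (x powr (- (a + e))) * indicator {1..} x" for x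
  have [measurable]: "h \<in> borel_measurable borel" unfolding h_def by measurable
  have "(\<integral>\<^sup>+ x. h x \<partial>lborel) = (\<integral>\<^sup>+ x. ennreal (x powr (- a)) * indicator {0..1} x \<partial>lborel)
      + (\<integral>\<^sup>+ x. ennreal (x powr (- (a + e))) * indicator {1..} x \<partial>lborel)"
    unfolding h_def by (rule nn_integral_add) auto
  also have "\<dots> < \<infinity>"
    using nn_integral_has_integral_lebesgue'[OF _ has_integral_powr_from_0[of "- a" 1]]
      nn_integral_has_integral_lebesgue'[OF _ has_integral_powr_to_inf[of "- (a + e)" 1]] assms
    by simp
  finally have h: "(\<integral>\<^sup>+ x. h x \<partial>lborel) < \<infinity>" .
  have h': "(\<integral>\<^sup>+ x. h (- x) \<partial>lborel) = (\<integral>\<^sup>+ x. h x \<partial>lborel)"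
    using nn_integral_real_affine[of h "-1" 0] by simp
  have pos: "pole_weight a e x \<le> h x" if "0 < x" for x :: real
  proof -
    have inv: "inverse (ennreal (norm x powr a)) = ennreal (x powr (- a))"
      using that by (simp add: inverse_ennreal powr_minus)
    show ?thesis
    proof (cases "x \<le> 1")
      case True
      have "(1 + x\<^sup>2) powr (- e / 2) \<le> 1 powr (- e / 2)"
        using assms by (intro powr_mono2') auto
      then have "pole_weight a e x \<le> ennreal (x powr (- a)) * 1"
        unfolding pole_weight_def inv by (intro mult_left_mono) auto
      also have "\<dots> \<le> h x" using True that by (simp add: h_def)
      finally show ?thesis .
    next
      case False
      then have "(1 + x\<^sup>2) powr (- e / 2) \<le> x powr (- e)"
        using assms by (intro one_plus_square_powr_le) auto
      then have "pole_weight a e x \<le> ennreal (x powr (- a)) * ennreal (x powr (- e))"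
        unfolding pole_weight_def inv by (intro mult_left_mono ennreal_leI) auto
      also have "\<dots> = ennreal (x powr (- (a + e)))"
        using that by (simp add: ennreal_mult[symmetric] powr_add[symmetric])
      also have "\<dots> \<le> h x" using False by (simp add: h_def)
      finally show ?thesis .
    qed
  qed
  have "pole_weight a e x \<le> h x + h (- x)" if "x \<noteq> 0" for x :: real
  proof (cases "0 < x")
    case True
    then show ?thesis using pos[of x] by (simp add: add_increasing2)
  next
    case False
    then have "pole_weight a e (- x) \<le> h (- x)" using that by (intro pos) auto
    then show ?thesis by (simp add: add_increasing pole_weight_def)
  qed
  then have "(\<integral>\<^sup>+ x. pole_weight a e (x::real) \<partial>lborel) \<le> (\<integral>\<^sup>+ x. h x + h (- x) \<partial>lborel)"
    using AE_lborel_singleton[of "0::real"] by (intro nn_integral_mono_AE) auto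
  also have "\<dots> = (\<integral>\<^sup>+ x. h x \<partial>lborel) + (\<integral>\<^sup>+ x. h x \<partial>lborel)"
    using h' by (subst nn_integral_add) auto
  also have "\<dots> < \<infinity>" using h by simp
  finally show ?thesis .
qed


text \<open>
  As \<open>|z|\<^sup>2 \<ge> |Re z| |Im z|\<close> and \<open>(1 + |z|\<^sup>2)\<^sup>2 \<ge> (1 + (Re z)\<^sup>2) (1 + (Im z)\<^sup>2)\<close>, a weight on the plane is at
  most a product of weights on the line.
\<close>

lemma pole_weight_complex_le:
  assumes "0 \<le> a" "0 \<le> e"
  shows "pole_weight (2 * a) (2 * e) (z::complex) \<le> (\<Prod>b\<in>Basis. pole_weight a e (inner z b))"
proof -
  define x y where "x = \<bar>Re z\<bar>" and "y = \<bar>Im z\<bar>"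
  have xy: "0 \<le> x" "0 \<le> y" "x \<le> cmod z" "y \<le> cmod z" "(cmod z)\<^sup>2 = x\<^sup>2 + y\<^sup>2"
    by (auto simp: x_def y_def abs_Re_le_cmod abs_Im_le_cmod cmod_power2)
  have "x powr a * y powr a \<le> cmod z powr a * cmod z powr a"
    using xy assms by (intro mult_mono powr_mono2) auto
  also have "\<dots> = cmod z powr (2 * a)" by (simp flip: powr_add)
  finally have 1: "inverse (ennreal (cmod z powr (2 * a))) \<le> inverse (ennreal (x powr a * y powr a))"
    by (rule inverse_ennreal_antimono)
  have "((1 + x\<^sup>2) * (1 + y\<^sup>2)) powr (e / 2) \<le> ((1 + (cmod z)\<^sup>2)\<^sup>2) powr (e / 2)"
  proof (intro powr_mono2)
    have "(1 + (cmod z)\<^sup>2)\<^sup>2 = (1 + x\<^sup>2) * (1 + y\<^sup>2) + (x\<^sup>2 + y\<^sup>2 + x^4 + x\<^sup>2 * y\<^sup>2 + y^4)"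
      unfolding xy by (simp add: power2_eq_square power4_eq_xxxx algebra_simps)
    then show "(1 + x\<^sup>2) * (1 + y\<^sup>2) \<le> (1 + (cmod z)\<^sup>2)\<^sup>2" by simp
  qed (use assms in auto)
  also have "\<dots> = (1 + (cmod z)\<^sup>2) powr e"
    by (simp add: powr_powr add_pos_nonneg flip: powr_numeral)
  finally have "inverse ((1 + (cmod z)\<^sup>2) powr e) \<le> inverse (((1 + x\<^sup>2) * (1 + y\<^sup>2)) powr (e / 2))"
    by (intro le_imp_inverse_le) (auto simp: add_nonneg_eq_0_iff)
  then have "(1 + (cmod z)\<^sup>2) powr (- e) \<le> (1 + x\<^sup>2) powr (- e / 2) * (1 + y\<^sup>2) powr (- e / 2)"
    by (simp add: powr_minus powr_mult flip: minus_divide_left)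
  then have 2: "ennreal ((1 + (cmod z)\<^sup>2) powr (- (2 * e) / 2))
      \<le> ennreal ((1 + x\<^sup>2) powr (- e / 2)) * ennreal ((1 + y\<^sup>2) powr (- e / 2))"
    by (simp add: ennreal_mult[symmetric] ennreal_leI)
  have "pole_weight (2 * a) (2 * e) z \<le> inverse (ennreal (x powr a * y powr a)) *
      (ennreal ((1 + x\<^sup>2) powr (- e / 2)) * ennreal ((1 + y\<^sup>2) powr (- e / 2)))"
    unfolding pole_weight_def by (intro mult_mono 1 2) auto
  also have "\<dots> = pole_weight a e (Re z) * pole_weight a e (Im z)"
    by (simp add: pole_weight_def ennreal_mult ennreal_inverse_mult x_def y_def mult_ac)
  also have "\<dots> = (\<Prod>b\<in>Basis. pole_weight a e (inner z b))"
    by (simp add: Basis_complex_def)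
  finally show ?thesis .
qed

lemma nn_integral_pole_weight_complex:
  assumes "0 \<le> a" "a < 1" "1 < a + e"
  shows "(\<integral>\<^sup>+ z. pole_weight (2 * a) (2 * e) (z::complex) \<partial>lborel) < \<infinity>"
proof -
  have "(\<integral>\<^sup>+ z. pole_weight (2 * a) (2 * e) (z::complex) \<partial>lborel)
      \<le> (\<integral>\<^sup>+ z. (\<Prod>b\<in>Basis. pole_weight a e (inner z b)) \<partial>(lborel :: complex measure))"
    using assms by (intro nn_integral_mono pole_weight_complex_le) auto
  also have "\<dots> = (\<Prod>b\<in>(Basis :: complex set). \<integral>\<^sup>+ x. pole_weight a e (x::real) \<partial>lborel)"
    by (rule nn_integral_lborel_prod) auto
  also have "\<dots> < \<infinity>"
    using nn_integral_pole_weight_real[OF assms] by (simp add: Basis_complex_def ennreal_mult_less_top)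
  finally show ?thesis .
qed

lemma nn_integral_prod_pole_weight:
  fixes J :: "'i set"
  assumes "finite J" "\<And>j. j \<in> J \<Longrightarrow> 0 \<le> a j \<and> a j < 1 \<and> 1 < a j + e j"
  shows "(\<integral>\<^sup>+ w. (\<Prod>j\<in>J. pole_weight (2 * a j) (2 * e j) (w j :: complex)) \<partial>(\<Pi>\<^sub>M j\<in>J. lborel)) < \<infinity>"
proof -
  interpret product_sigma_finite "\<lambda>_::'i. lborel :: complex measure" ..
  have "(\<integral>\<^sup>+ w. (\<Prod>j\<in>J. pole_weight (2 * a j) (2 * e j) (w j :: complex)) \<partial>(\<Pi>\<^sub>M j\<in>J. lborel))
      = (\<Prod>j\<in>J. \<integral>\<^sup>+ z. pole_weight (2 * a j) (2 * e j) (z::complex) \<partial>lborel)"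
    by (rule product_nn_integral_prod[OF assms(1)]) simp
  also have "\<dots> < \<infinity>"
    using assms
  proof (induction J rule: finite_induct)
    case (insert j J)
    then show ?case using nn_integral_pole_weight_complex[of "a j" "e j"]
      by (simp add: ennreal_mult_less_top)
  qed simp
  finally show ?thesis .
qed


section \<open>The determinant of the Fubini-Study metric\<close>


text \<open>
  The matrix determinant lemma \<open>det (1 + u v\<^sup>T) = 1 + v\<^sup>T u\<close>, obtained from two triangular factorisations
  of the block matrix with rows \<open>(1, -u)\<close> and \<open>(v\<^sup>T, 1)\<close>.
\<close>

lemma det_one_plus_rank_one:
  fixes u v :: "nat \<Rightarrow> 'a::idom"
  shows "Determinant.det (mat n n (\<lambda>(a, b). (if a = b then 1 else 0) + u a * v b)) = 1 + (\<Sum>a<n. u a * v a)"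
proof -
  define W where "W = mat n n (\<lambda>(a, b). (if a = b then 1 else 0) + u a * v b)"
  define U where "U = mat n 1 (\<lambda>(a, _). - u a)"
  define V where "V = mat 1 n (\<lambda>(_, b). v b)"
  define T where "T = mat 1 1 (\<lambda>_. 1 + (\<Sum>a<n. u a * v a))"
  have c: "W \<in> carrier_mat n n" "U \<in> carrier_mat n 1" "V \<in> carrier_mat 1 n" "T \<in> carrier_mat 1 1"
    by (auto simp: W_def U_def V_def T_def)
  have 1: "W + U * V = 1\<^sub>m n"
    by (intro eq_matI) (auto simp: W_def U_def V_def scalar_prod_def)
  have 2: "V * U + T = 1\<^sub>m 1"
    by (intro eq_matI) (auto simp: T_def U_def V_def scalar_prod_def sum_negf mult.commute atLeast0LessThan)
  let ?L = "four_block_mat (1\<^sub>m n) (0\<^sub>m n 1) V (1\<^sub>m 1)"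
  have "?L * four_block_mat (1\<^sub>m n) U (0\<^sub>m 1 n) T = four_block_mat (1\<^sub>m n) U V (1\<^sub>m 1)"
    using c 2 by (subst mult_four_block_mat[where ?nr1.0 = n and ?n1.0 = n and ?n2.0 = 1 and ?nr2.0 = 1 and ?nc1.0 = n and ?nc2.0 = 1]) auto
  also have "\<dots> = four_block_mat W U (0\<^sub>m 1 n) (1\<^sub>m 1) * ?L"
    using c 1 by (subst mult_four_block_mat[where ?nr1.0 = n and ?n1.0 = n and ?n2.0 = 1 and ?nr2.0 = 1 and ?nc1.0 = n and ?nc2.0 = 1]) auto
  finally have eq: "Determinant.det (?L * four_block_mat (1\<^sub>m n) U (0\<^sub>m 1 n) T)
      = Determinant.det (four_block_mat W U (0\<^sub>m 1 n) (1\<^sub>m 1) * ?L)" by simp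
  have "Determinant.det ?L = 1"
    using c by (subst det_four_block_mat_upper_right_zero[where n = n and m = 1]) auto
  moreover have "Determinant.det (four_block_mat (1\<^sub>m n) U (0\<^sub>m 1 n) T) = Determinant.det T"
    using c by (subst det_four_block_mat_lower_left_zero[where n = n and m = 1]) auto
  moreover have "Determinant.det (four_block_mat W U (0\<^sub>m 1 n) (1\<^sub>m 1)) = Determinant.det W"
    using c by (subst det_four_block_mat_lower_left_zero[where n = n and m = 1]) auto
  moreover have "?L \<in> carrier_mat (n + 1) (n + 1)"
    "four_block_mat (1\<^sub>m n) U (0\<^sub>m 1 n) T \<in> carrier_mat (n + 1) (n + 1)"
    "four_block_mat W U (0\<^sub>m 1 n) (1\<^sub>m 1) \<in> carrier_mat (n + 1) (n + 1)"
    using c by auto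
  ultimately have "Determinant.det T = Determinant.det W"
    using eq by (simp add: det_mult[of _ "n + 1"])
  moreover have "Determinant.det T = 1 + (\<Sum>a<n. u a * v a)"
    by (subst det_single) (auto simp: T_def)
  ultimately show ?thesis by (simp add: W_def)
qed

lemma det_fubini_study:
  fixes w :: "nat \<Rightarrow> complex" and c :: complex and m :: nat
  defines "S \<equiv> 1 + (\<Sum>j=1..m. (cmod (w j))\<^sup>2)"
  shows "Determinant.det (mat m m (\<lambda>(a, b). c * ((if a = b then 1 else 0) / of_real S
           - w (Suc b) * cnj (w (Suc a)) / (of_real S)\<^sup>2))) = c ^ m / of_real (S ^ (m + 1))"
proof -
  have "0 < S" unfolding S_def by (intro add_pos_nonneg sum_nonneg) auto
  then have S: "S \<noteq> 0" "complex_of_real S \<noteq> 0" by auto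
  have "mat m m (\<lambda>(a, b). c * ((if a = b then 1 else 0) / of_real S - w (Suc b) * cnj (w (Suc a)) / (of_real S)\<^sup>2))
      = (c / of_real S) \<cdot>\<^sub>m mat m m (\<lambda>(a, b). (if a = b then 1 else 0) + (- cnj (w (Suc a)) / of_real S) * w (Suc b))"
    using S by (intro eq_matI) (auto simp: field_simps power2_eq_square)
  moreover have "1 + (\<Sum>a<m. (- cnj (w (Suc a)) / of_real S) * w (Suc a)) = 1 / of_real S"
  proof -
    have "(\<Sum>a<m. cnj (w (Suc a)) * w (Suc a)) = of_real (\<Sum>j=1..m. (cmod (w j))\<^sup>2)"
      by (simp add: complex_norm_square mult.commute sum.atLeast1_atMost_eq del: of_real_power)
    also have "\<dots> = of_real S - 1" by (simp add: S_def)
    finally have "(\<Sum>a<m. (- cnj (w (Suc a)) / of_real S) * w (Suc a)) = - ((of_real S - 1) / of_real S)"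
      by (simp add: sum_divide_distrib[symmetric] sum_negf)
    then show ?thesis using S by (simp add: field_simps)
  qed
  ultimately show ?thesis
    by (simp only: det_smult det_one_plus_rank_one) (simp add: power_divide)
qed


section \<open>Invariant admissible functions on projective space\<close>

lemma proj_pt_scale:
  assumes "z \<in> hvec m" "c \<noteq> 0"
  shows "proj_pt m (\<lambda>j. c * z j) = proj_pt m z" "(\<lambda>j. c * z j) \<in> hvec m"
proof -
  show "(\<lambda>j. c * z j) \<in> hvec m" using assms by (auto simp: hvec_def)
  then have "(z, \<lambda>j. c * z j) \<in> proj_rel m" using assms by (auto simp: proj_rel_def)
  then show "proj_pt m (\<lambda>j. c * z j) = proj_pt m z"
    unfolding proj_pt_def by (rule equiv_class_eq[OF equiv_proj_rel, symmetric])
qed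

lemma chart_subset_hvec: "l \<le> m \<Longrightarrow> z \<in> chart m l \<Longrightarrow> z \<in> hvec m"
  by (auto simp: chart_def hvec_def intro!: exI[of _ l])

lemma proj_pt_in_cproj: "z \<in> hvec m \<Longrightarrow> proj_pt m z \<in> cproj m"
  by (auto simp: cproj_def proj_pt_def intro: quotientI)

lemma cproj_cases:
  assumes "p \<in> cproj m"
  obtains l z where "l \<le> m" "z \<in> chart m l" "p = proj_pt m z"
proof -
  obtain y where y: "y \<in> hvec m" "p = proj_pt m y"
    using assms by (auto simp: cproj_def proj_pt_def elim: quotientE)
  then obtain l where l: "l \<le> m" "y l \<noteq> 0" by (auto simp: hvec_def)
  show thesis
  proof
    show "(\<lambda>j. inverse (y l) * y j) \<in> chart m l" using y l by (auto simp: chart_def hvec_def)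
    show "p = proj_pt m (\<lambda>j. inverse (y l) * y j)" using y l by (simp add: proj_pt_scale)
  qed fact
qed

lemma induced_map_proj_pt:
  assumes T: "\<And>z c. T (\<lambda>j. c * z j) = (\<lambda>j. c * T z j)"
    and S: "\<And>z c. S (\<lambda>j. c * z j) = (\<lambda>j. c * S z j)"
    and hT: "\<And>z. z \<in> hvec m \<Longrightarrow> T z \<in> hvec m" and hS: "\<And>z. z \<in> hvec m \<Longrightarrow> S z \<in> hvec m"
    and I: "\<And>z. T (S z) = z" "\<And>z. S (T z) = z" and z: "z \<in> hvec m"
  shows "induced_map m T (proj_pt m z) = proj_pt m (T z)"
proof -
  have "w \<in> T ` proj_pt m z \<longleftrightarrow> w \<in> proj_pt m (T z)" for w
  proof
    assume "w \<in> T ` proj_pt m z"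
    then show "w \<in> proj_pt m (T z)"
      using hT T by (auto simp: proj_pt_def proj_rel_def)
  next
    assume "w \<in> proj_pt m (T z)"
    then obtain c where "w \<in> hvec m" "c \<noteq> 0" "w = (\<lambda>j. c * T z j)"
      by (auto simp: proj_pt_def proj_rel_def)
    then have "S w \<in> proj_pt m z" using S[of c "T z"] I z proj_pt_scale(2)[OF z] by (auto simp: proj_pt_def proj_rel_def)
    then have "T (S w) \<in> T ` proj_pt m z" by (rule imageI)
    then show "w \<in> T ` proj_pt m z" by (simp add: I)
  qed
  then show ?thesis using proj_pt_in_cproj[OF z] by (auto simp: induced_map_def)
qed


text \<open>
  The point of \<open>\<complex>\<^sup>m\<^sup>+\<^sup>1\<close> with positive real coordinates and logarithmic radii \<open>x\<close>.
\<close>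

definition exp_point :: "nat \<Rightarrow> (nat \<Rightarrow> real) \<Rightarrow> nat \<Rightarrow> complex" where
  "exp_point m x = (\<lambda>j. if j \<le> m then of_real (exp (x j)) else 0)"

lemma exp_point_hvec: "exp_point m x \<in> hvec m"
  by (auto simp: exp_point_def hvec_def intro!: exI[of _ 0])

lemma sqnorm_exp_point: "sqnorm m (exp_point m x) = (\<Sum>j=0..m. exp (2 * x j))"
  unfolding sqnorm_def by (intro sum.cong) (auto simp: exp_point_def exp_double)

lemma sqnorm_exp_point_pos: "0 < sqnorm m (exp_point m x)"
  unfolding sqnorm_exp_point by (intro sum_pos) auto


text \<open>
  The functions of the theorem: smooth, admissible, \<open>G\<close>-invariant, with supremum \<open>0\<close>.
\<close>

locale invariant_potential =
  fixes m k :: nat and \<phi> :: "(nat \<Rightarrow> complex) set \<Rightarrow> real"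
  assumes m2: "2 \<le> m" and km: "k < m"
    and smooth: "smooth_cproj m \<phi>" and adm: "admissible m \<phi>" and inv: "G_invariant m k \<phi>"
    and sup: "(SUP p\<in>cproj m. ereal (\<phi> p)) = 0"
begin


text \<open>
  The function \<open>\<phi>\<close> lifted to homogeneous coordinates.
\<close>

definition \<Phi> :: "(nat \<Rightarrow> complex) \<Rightarrow> real" where "\<Phi> z = \<phi> (proj_pt m z)"

lemma \<Phi>_nonpos: "z \<in> hvec m \<Longrightarrow> \<Phi> z \<le> 0"
  using SUP_upper[OF proj_pt_in_cproj, of z m "\<lambda>p. ereal (\<phi> p)"] by (simp add: sup \<Phi>_def)

lemma \<Phi>_scale: "z \<in> hvec m \<Longrightarrow> c \<noteq> 0 \<Longrightarrow> \<Phi> (\<lambda>j. c * z j) = \<Phi> z"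
  by (simp add: \<Phi>_def proj_pt_scale)

lemma \<phi>_gen: "\<gamma> \<in> G_gens m k \<Longrightarrow> p \<in> cproj m \<Longrightarrow> \<phi> (\<gamma> p) = \<phi> p"
  using inv unfolding G_invariant_def G_group_def by (blast intro: generate.incl)

lemma \<Phi>_swap:
  assumes z: "z \<in> hvec m" and ij: "i \<le> m" "j \<le> m" "i \<le> k \<longleftrightarrow> j \<le> k"
  shows "\<Phi> (swap_coord i j z) = \<Phi> z"
proof -
  have "induced_map m (swap_coord i j) \<in> G_gens m k"
  proof (cases "i \<le> k")
    case True
    then show ?thesis using ij unfolding G_gens_def by auto
  next
    case False
    then have "i \<in> {k+1..m}" "j \<in> {k+1..m}" using ij by auto
    then show ?thesis unfolding G_gens_def by blast
  qed
  moreover have "induced_map m (swap_coord i j) (proj_pt m z) = proj_pt m (swap_coord i j z)"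
    using z ij
    by (intro induced_map_proj_pt[where S = "swap_coord i j"])
      (simp_all add: swap_coord_hvec, simp_all add: swap_coord_def fun_eq_iff)
  ultimately show ?thesis
    using \<phi>_gen[OF _ proj_pt_in_cproj[OF z]] by (fastforce simp: \<Phi>_def)
qed

lemma \<Phi>_rot1:
  assumes z: "z \<in> hvec m" and a: "a \<le> m" and w: "cmod w = cmod (z a)"
  shows "\<Phi> (z(a := w)) = \<Phi> z"
proof (cases "z a = 0")
  case True
  then show ?thesis using w by (simp add: fun_upd_idem)
next
  case False
  then have "cmod (w / z a) = 1" using w by (simp add: norm_divide)
  then obtain \<theta> where \<theta>: "0 \<le> \<theta>" "\<theta> < 2 * pi" "w / z a = Complex (cos \<theta>) (sin \<theta>)"
    by (rule complex_unimodular_polar)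
  then have "w / z a = exp (\<i> * of_real \<theta>)" by (simp add: cis_conv_exp[symmetric] cis.ctr)
  then have "w = z a * exp (\<i> * of_real \<theta>)" using False by (metis nonzero_mult_div_cancel_left times_divide_eq_right)
  then have "z(a := w) = rot_coord a \<theta> z" by (simp only: rot_coord_def)
  moreover have "induced_map m (rot_coord a \<theta>) \<in> G_gens m k"
    using a \<theta> unfolding G_gens_def by force
  moreover have "induced_map m (rot_coord a \<theta>) (proj_pt m z) = proj_pt m (rot_coord a \<theta> z)"
    using z
    by (intro induced_map_proj_pt[where S = "rot_coord a (- \<theta>)"])
      (simp_all add: rot_coord_hvec, simp_all add: rot_coord_def fun_eq_iff exp_minus)
  ultimately show ?thesis
    using \<phi>_gen[OF _ proj_pt_in_cproj[OF z]] by (fastforce simp: \<Phi>_def)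
qed

lemma \<Phi>_rot:
  assumes z: "z \<in> hvec m" and w: "\<And>j. cmod (w j) = cmod (z j)"
  shows "\<Phi> w = \<Phi> z"
proof -
  have w0: "w j = 0 \<longleftrightarrow> z j = 0" for j using w[of j] by (metis norm_eq_zero)
  define y where "y n = (\<lambda>j. if j < n then w j else z j)" for n
  have y: "y n \<in> hvec m" for n
  proof -
    have *: "y n j = 0 \<longleftrightarrow> z j = 0" for j by (simp add: y_def w0)
    show ?thesis using z unfolding hvec_def mem_Collect_eq * .
  qed
  have "n \<le> Suc m \<Longrightarrow> \<Phi> (y n) = \<Phi> z" for n
  proof (induction n)
    case (Suc n)
    have "y (Suc n) = (y n)(n := w n)" by (auto simp: y_def less_Suc_eq)
    moreover have "\<Phi> ((y n)(n := w n)) = \<Phi> (y n)"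
      using Suc.prems w[of n] by (intro \<Phi>_rot1 y) (simp_all add: y_def)
    ultimately have "\<Phi> (y (Suc n)) = \<Phi> (y n)" by (simp only:)
    then show ?case using Suc by simp
  qed (simp add: y_def)
  from this[of "Suc m"] have "\<Phi> (y (Suc m)) = \<Phi> z" by simp
  moreover have "y (Suc m) = w"
  proof
    fix j show "y (Suc m) j = w j"
      using w0[of j] z by (cases "j < Suc m") (auto simp: y_def hvec_def)
  qed
  ultimately show ?thesis by simp
qed

lemma torus_symmetric_chart:
  assumes l: "l \<le> m" shows "torus_symmetric_chart m l \<Phi>"
proof
  show "smooth_chart m l \<Phi>" using smooth l unfolding smooth_cproj_def \<Phi>_def by simp
  show "\<Phi> (z(a := w)) = \<Phi> z" if "z \<in> chart m l" "a \<in> chart_idx m l" "cmod w = cmod (z a)" for z a w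
    using that chart_subset_hvec[OF l] by (intro \<Phi>_rot1) (auto simp: chart_idx_def)
qed

text \<open>
  The potential of the metric \<open>g\<close> perturbed by \<open>\<phi>\<close>, in logarithmic radii.
\<close>

definition u :: "(nat \<Rightarrow> real) \<Rightarrow> real" where
  "u x = \<Phi> (exp_point m x) + (real m + 1) * ln (sqnorm m (exp_point m x))"

lemma u_shift: "u (\<lambda>l. x l + c) = u x + 2 * (real m + 1) * c"
proof -
  have "exp_point m (\<lambda>l. x l + c) = (\<lambda>j. of_real (exp c) * exp_point m x j)"
    by (auto simp: exp_point_def exp_add)
  then have "\<Phi> (exp_point m (\<lambda>l. x l + c)) = \<Phi> (exp_point m x)"
    by (simp add: \<Phi>_scale exp_point_hvec)
  moreover have "sqnorm m (exp_point m (\<lambda>l. x l + c)) = exp (2 * c) * sqnorm m (exp_point m x)"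
    by (simp add: sqnorm_exp_point distrib_left exp_add sum_distrib_left mult.commute)
  then have "ln (sqnorm m (exp_point m (\<lambda>l. x l + c))) = 2 * c + ln (sqnorm m (exp_point m x))"
    using sqnorm_exp_point_pos[of m x] by (simp add: ln_mult)
  ultimately show ?thesis by (simp add: u_def algebra_simps)
qed

lemma u_convex:
  assumes ij: "i \<le> m" "j \<le> m" "i \<noteq> j"
  shows "convex_on UNIV (\<lambda>t. u (x(i := x i + p * t, j := x j + q * t)))"
proof -
  (* as m >= 2, some chart z_l = 1 has both i and j among its coordinates *)
  have "card {i, j} < card {0..m}" using m2 ij(3) by simp
  then have "\<not> {0..m} \<subseteq> {i, j}" by (meson card_mono finite.emptyI finite_insert leD)
  then have "\<exists>l\<in>{0..m}. l \<notin> {i, j}" by blast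
  then obtain l where l: "l \<le> m" "l \<noteq> i" "l \<noteq> j" by auto
  interpret torus_symmetric_chart m l \<Phi> by (rule torus_symmetric_chart) fact
  (* the same point of projective space, normalised to lie in that chart *)
  define y where "y = (\<lambda>l'. x l' + (- x l))"
  have idx: "i \<in> chart_idx m l" "j \<in> chart_idx m l" using ij l by (auto simp: chart_idx_def)
  have chart: "exp_point m y \<in> chart m l" using l(1) by (simp add: exp_point_def chart_def y_def)
  let ?\<gamma> = "\<lambda>t. (exp_point m y)(i := complex_of_real (exp (y i + p * t)), j := of_real (exp (y j + q * t)))"
  have \<gamma>: "?\<gamma> t = exp_point m (y(i := y i + p * t, j := y j + q * t))" for t
    using ij(1,2) by (simp add: exp_point_def fun_eq_iff)
  have "convex_on UNIV (\<lambda>t. \<Phi> (?\<gamma> t) + (real m + 1) * ln (sqnorm m (?\<gamma> t)))"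
  proof (rule convex_along_log_radii[OF l(1) ij(3) idx chart])
    show "pos_def_hermitian (chart_idx m l) (\<lambda>a b. g_comp m a b z + ddbar a b \<Phi> z)"
      if "z \<in> chart m l" for z
      using adm l(1) that unfolding admissible_def \<Phi>_def[abs_def] by blast
  qed
  then have "convex_on UNIV (\<lambda>t. u (y(i := y i + p * t, j := y j + q * t)))"
    unfolding \<gamma> u_def .
  then have "convex_on UNIV (\<lambda>t. u (y(i := y i + p * t, j := y j + q * t)) + 2 * (real m + 1) * x l)"
    by (rule convex_on_add) (simp add: convex_on_const)
  moreover have "u (x(i := x i + p * t, j := x j + q * t)) = u (y(i := y i + p * t, j := y j + q * t)) + 2 * (real m + 1) * x l" for t
  proof -
    have "x(i := x i + p * t, j := x j + q * t) = (\<lambda>l'. (y(i := y i + p * t, j := y j + q * t)) l' + x l)"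
      by (simp add: y_def fun_eq_iff)
    then show ?thesis by (simp only: u_shift)
  qed
  ultimately show ?thesis by (simp only:)
qed


text \<open>
  The supremum is already approached at points with no vanishing coordinate.
\<close>

lemma exists_near_sup:
  assumes "0 < e"
  shows "\<exists>x. - e < \<Phi> (exp_point m x)"
proof -
  have "ereal (- e) < (SUP p\<in>cproj m. ereal (\<phi> p))" using assms by (simp add: sup)
  then obtain p where p: "p \<in> cproj m" "- e < \<phi> p"
    unfolding less_SUP_iff ereal_less_eq less_ereal.simps by blast
  then obtain l z where z: "l \<le> m" "z \<in> chart m l" "p = proj_pt m z" by (blast elim: cproj_cases)
  interpret torus_symmetric_chart m l \<Phi> by (rule torus_symmetric_chart) fact
  (* moves the vanishing coordinates of z off zero *)
  define Z where "Z s = (\<lambda>j. if j \<le> m \<and> z j = 0 then complex_of_real s else z j)" for s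
  have Z: "Z s \<in> chart m l" for s using z by (auto simp: Z_def chart_def)
  have cZ: "continuous_on UNIV Z"
  proof (rule continuous_on_coordinatewise_then_product)
    show "continuous_on UNIV (\<lambda>s. Z s j)" for j
      by (cases "j \<le> m \<and> z j = 0") (auto simp: Z_def intro!: continuous_intros)
  qed
  have c\<Phi>: "continuous_on (chart m l) \<Phi>"
    using smooth_chartD(1)[OF smooth, of "[]"] by simp
  have "continuous_on UNIV (\<lambda>s. \<Phi> (Z s))"
    by (rule continuous_on_compose2[OF c\<Phi> cZ]) (use Z in blast)
  then have "isCont (\<lambda>s. \<Phi> (Z s)) 0" by (simp add: continuous_on_eq_continuous_at)
  then have "(\<lambda>s. \<Phi> (Z s)) \<midarrow>0\<rightarrow> \<Phi> (Z 0)" by (rule isContD)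
  moreover have "- e < \<Phi> (Z 0)"
  proof -
    have "Z 0 = z" by (simp add: Z_def fun_eq_iff)
    then show ?thesis using p(2) by (simp add: z(3) \<Phi>_def)
  qed
  ultimately have "eventually (\<lambda>s. - e < \<Phi> (Z s)) (at 0)" by (rule order_tendstoD(1))
  then obtain d where d: "0 < d" "\<And>s. s \<noteq> 0 \<Longrightarrow> dist s 0 < d \<Longrightarrow> - e < \<Phi> (Z s)"
    unfolding eventually_at by blast
  define w where "w = Z (d / 2)"
  have w: "- e < \<Phi> w" unfolding w_def by (rule d(2)) (use d(1) in auto)
  have "\<Phi> (exp_point m (\<lambda>j. ln (cmod (w j)))) = \<Phi> w"
  proof (rule \<Phi>_rot)
    show "w \<in> hvec m" unfolding w_def using Z z(1) by (rule chart_subset_hvec[rotated])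
    show "cmod (exp_point m (\<lambda>j. ln (cmod (w j))) j) = cmod (w j)" for j
    proof (cases "j \<le> m")
      case True
      then have "w j \<noteq> 0" using d(1) by (simp add: w_def Z_def)
      then show ?thesis using True by (simp add: exp_point_def)
    next
      case False
      then show ?thesis using z(2) by (simp add: exp_point_def w_def Z_def chart_def)
    qed
  qed
  with w have "- e < \<Phi> (exp_point m (\<lambda>j. ln (cmod (w j))))" by (simp only:)
  then show ?thesis by (rule exI[of _ "\<lambda>j. ln (cmod (w j))"])
qed

sublocale torus_potential m k u
proof
  show "1 \<le> m" using m2 by simp
  show "k < m" by (rule km)
  show "u x = u y" if "\<And>l. l \<le> m \<Longrightarrow> x l = y l" for x y
  proof -
    have "exp_point m x = exp_point m y" using that by (auto simp: exp_point_def)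
    then show ?thesis by (simp add: u_def)
  qed
  show "u (x(i := x j, j := x i)) = u x" if ij: "i \<le> m" "j \<le> m" "i \<le> k \<longleftrightarrow> j \<le> k" for x i j
  proof (cases "i = j")
    case False
    have e: "exp_point m (x(i := x j, j := x i)) = swap_coord i j (exp_point m x)"
      using ij by (auto simp: exp_point_def swap_coord_def)
    have "sqnorm m (swap_coord i j (exp_point m x)) = sqnorm m (exp_point m x)"
      using False ij by (simp add: swap_coord_def sqnorm_upd)
    then show ?thesis using ij by (simp add: u_def e \<Phi>_swap exp_point_hvec)
  qed simp
  show "u x \<le> (real m + 1) * ln (\<Sum>l = 0..m. exp (2 * x l))" for x
    using \<Phi>_nonpos[OF exp_point_hvec] by (simp add: u_def sqnorm_exp_point)
  show "\<exists>x. (real m + 1) * ln (\<Sum>l = 0..m. exp (2 * x l)) - e \<le> u x" if "0 < e" for e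
    using exists_near_sup[OF that] by (auto simp: u_def sqnorm_exp_point intro: less_imp_le)
qed (fact u_shift u_convex)+

lemma \<Phi>_lower_bound:
  assumes "\<And>l. l \<le> m \<Longrightarrow> w l \<noteq> 0" "w \<in> hvec m"
  shows "2 * (real m + 1) * min ((\<Sum>l=0..k. ln (cmod (w l))) / (real k + 1))
      ((\<Sum>l=k+1..m. ln (cmod (w l))) / (real m - real k)) \<le> \<Phi> w + (real m + 1) * ln (sqnorm m w)"
proof -
  define x where "x = (\<lambda>l. ln (cmod (w l)))"
  have n: "cmod (exp_point m x l) = cmod (w l)" for l
    using assms by (cases "l \<le> m") (auto simp: exp_point_def x_def hvec_def)
  then have "\<Phi> (exp_point m x) = \<Phi> w" by (intro \<Phi>_rot assms(2))
  moreover have "sqnorm m (exp_point m x) = sqnorm m w" by (simp add: sqnorm_def n)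
  ultimately have "u x = \<Phi> w + (real m + 1) * ln (sqnorm m w)" by (simp only: u_def)
  then show ?thesis using lower_bound[of x] by (simp only: x_def)
qed

end


section \<open>The integral estimate\<close>

text \<open>
  The power of \<open>S = 1 + \<Sum>|w\<^sub>j|\<^sup>2\<close> is shared out among the variables, as \<open>S \<ge> 1 + |w\<^sub>j|\<^sup>2\<close> for every \<open>j\<close>.
\<close>

lemma prod_pole_weight_ge:
  fixes w :: "'i \<Rightarrow> complex"
  assumes J: "finite J" and w: "\<And>j. j \<in> J \<Longrightarrow> w j \<noteq> 0" and e: "\<And>j. j \<in> J \<Longrightarrow> 0 \<le> e j"
  shows "ennreal ((1 + (\<Sum>j\<in>J. (cmod (w j))\<^sup>2)) powr (- sum e J) * exp (- (2 * (\<Sum>j\<in>J. a j * ln (cmod (w j))))))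
    \<le> (\<Prod>j\<in>J. pole_weight (2 * a j) (2 * e j) (w j))"
proof -
  define S where "S = 1 + (\<Sum>j\<in>J. (cmod (w j))\<^sup>2)"
  have S1: "1 \<le> S" unfolding S_def by (simp add: sum_nonneg)
  have S: "1 + (cmod (w j))\<^sup>2 \<le> S" if "j \<in> J" for j
    unfolding S_def using J that by (intro add_left_mono member_le_sum) auto
  have "S powr (- sum e J) = (\<Prod>j\<in>J. S powr (- e j))"
    using S1 J by (simp add: powr_sum sum_negf[symmetric])
  moreover have "exp (- (2 * (\<Sum>j\<in>J. a j * ln (cmod (w j))))) = (\<Prod>j\<in>J. cmod (w j) powr (- (2 * a j)))"
    using J w by (simp add: exp_sum[symmetric] powr_def sum_distrib_left sum_negf[symmetric] mult.assoc)
  ultimately have "S powr (- sum e J) * exp (- (2 * (\<Sum>j\<in>J. a j * ln (cmod (w j)))))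
      = (\<Prod>j\<in>J. cmod (w j) powr (- (2 * a j)) * S powr (- e j))"
    by (simp add: prod.distrib)
  also have "\<dots> \<le> (\<Prod>j\<in>J. cmod (w j) powr (- (2 * a j)) * (1 + (cmod (w j))\<^sup>2) powr (- e j))"
    using S e by (intro prod_mono conjI mult_left_mono powr_mono2') (auto simp: add_pos_nonneg)
  finally have "ennreal (S powr (- sum e J) * exp (- (2 * (\<Sum>j\<in>J. a j * ln (cmod (w j))))))
      \<le> ennreal (\<Prod>j\<in>J. cmod (w j) powr (- (2 * a j)) * (1 + (cmod (w j))\<^sup>2) powr (- e j))"
    by (rule ennreal_leI)
  also have "\<dots> = (\<Prod>j\<in>J. ennreal (cmod (w j) powr (- (2 * a j)) * (1 + (cmod (w j))\<^sup>2) powr (- e j)))"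
    by (rule prod_ennreal[symmetric]) auto
  also have "\<dots> = (\<Prod>j\<in>J. pole_weight (2 * a j) (2 * e j) (w j))"
    using w by (intro prod.cong) (auto simp: pole_weight_def inverse_ennreal powr_minus ennreal_mult)
  finally show ?thesis unfolding S_def .
qed

lemma prod_pole_weight_top:
  fixes w :: "'i \<Rightarrow> complex"
  assumes "finite J" "i \<in> J" "w i = 0"
  shows "(\<Prod>j\<in>J. pole_weight (a j) (e j) (w j)) = \<infinity>"
proof -
  have nz: "pole_weight (a j) (e j) (w j) \<noteq> 0" for j
    by (auto simp: pole_weight_def add_nonneg_eq_0_iff)
  have "(\<Prod>j\<in>J - {i}. pole_weight (a j) (e j) (w j)) \<noteq> 0"
    using assms(1) nz by (induction "J - {i}" rule: infinite_finite_induct) (auto simp: prod_zero_iff)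
  moreover have "pole_weight (a i) (e i) (w i) = \<infinity>" using assms(3) by (simp add: pole_weight_def)
  ultimately show ?thesis using assms by (simp add: prod.remove[of J i])
qed


text \<open>
  With \<open>u = \<phi> + (m + 1) ln S\<close>, \<open>exp (-\<alpha> \<phi>) = S\<^sup>\<alpha>\<^sup>(\<^sup>m\<^sup>+\<^sup>1\<^sup>) exp (-\<alpha> u)\<close>. The exponents \<open>a\<close> and \<open>b\<close> spread
  \<open>\<alpha> u \<ge> 2 \<alpha> (m + 1) min(s, t)\<close> over the variables of the first and of the second block. The factor
  \<open>S\<^sup>m\<^sup>+\<^sup>1\<close> kept on the right is cancelled by the density of the volume.
\<close>

lemma (in invariant_potential) exp_neg_le:
  assumes \<alpha>: "0 < \<alpha>"
    and a: "\<And>j. a j = (if j \<le> k then \<alpha> * (real m + 1) / (real k + 1) else 0)"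
    and b: "\<And>j. b j = (if j \<le> k then 0 else \<alpha> * (real m + 1) / (real m - real k))"
    and e: "\<And>j. j \<in> {1..m} \<Longrightarrow> 0 \<le> e j" "sum e {1..m} = (1 - \<alpha>) * (real m + 1)"
    and f: "\<And>j. j \<in> {1..m} \<Longrightarrow> 0 \<le> f j" "sum f {1..m} = (1 - \<alpha>) * (real m + 1)"
  shows "ennreal (exp (- \<alpha> * \<phi> (proj_pt m (affine_vec m w)))) \<le>
    ennreal ((1 + (\<Sum>j=1..m. (cmod (w j))\<^sup>2)) ^ (m + 1)) *
     ((\<Prod>j=1..m. pole_weight (2 * a j) (2 * e j) (w j)) + (\<Prod>j=1..m. pole_weight (2 * b j) (2 * f j) (w j)))"
    (is "_ \<le> ennreal (?S ^ (m + 1)) * (?A + ?B)")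
proof (cases "\<exists>i\<in>{1..m}. w i = 0")
  case True
  then obtain i where i: "i \<in> {1..m}" "w i = 0" by blast
  have "?A = \<infinity>" by (rule prod_pole_weight_top[where i = i]) (use i in auto)
  moreover define c where "c = ennreal (?S ^ (m + 1))"
  have "0 < ?S ^ (m + 1)" by (intro zero_less_power add_pos_nonneg sum_nonneg) auto
  then have "c \<noteq> 0" unfolding c_def by (simp only: ennreal_eq_0_iff not_le)
  ultimately show ?thesis
    unfolding c_def[symmetric] by (simp add: infinity_ennreal_def)
next
  case False
  define W where "W = affine_vec m w"
  define S where "S = ?S"
  define L where "L l = ln (cmod (w l))" for l
  have nz: "W l \<noteq> 0" if "l \<le> m" for l
    using False that by (auto simp: W_def affine_vec_def)
  have WL: "ln (cmod (W l)) = (if l = 0 then 0 else L l)" if "l \<le> m" for l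
    using that by (simp add: W_def affine_vec_def L_def)
  have hv: "W \<in> hvec m" by (auto simp: W_def affine_vec_def hvec_def intro!: exI[of _ 0])
  have S: "sqnorm m W = S"
    by (simp add: sqnorm_def sum.atLeast_Suc_atMost W_def affine_vec_def S_def)
  have Spos: "0 < S" unfolding S_def by (intro add_pos_nonneg sum_nonneg) auto
  define s where "s = (\<Sum>j=1..m. a j * L j)"
  define t where "t = (\<Sum>j=1..m. b j * L j)"
  have s: "\<alpha> * ((real m + 1) * ((\<Sum>l=0..k. ln (cmod (W l))) / (real k + 1))) = s"
  proof -
    have "(\<Sum>l=0..k. ln (cmod (W l))) = (\<Sum>l=1..k. L l)"
      using km by (simp add: sum.atLeast_Suc_atMost WL)
    moreover have "s = (\<Sum>j=1..k. a j * L j)"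
      unfolding s_def using km by (intro sum.mono_neutral_right) (auto simp: a)
    ultimately show ?thesis by (simp add: a sum_distrib_left sum_divide_distrib mult_ac)
  qed
  have t: "\<alpha> * ((real m + 1) * ((\<Sum>l=k+1..m. ln (cmod (W l))) / (real m - real k))) = t"
  proof -
    have "(\<Sum>l=k+1..m. ln (cmod (W l))) = (\<Sum>l=k+1..m. L l)"
      by (intro sum.cong) (auto simp: WL)
    moreover have "t = (\<Sum>j=k+1..m. b j * L j)"
      unfolding t_def by (intro sum.mono_neutral_right) (auto simp: b)
    ultimately show ?thesis by (simp add: b sum_distrib_left sum_divide_distrib mult_ac)
  qed
  have "\<alpha> * (2 * (real m + 1) * min ((\<Sum>l=0..k. ln (cmod (W l))) / (real k + 1))
      ((\<Sum>l=k+1..m. ln (cmod (W l))) / (real m - real k))) \<le> \<alpha> * (\<Phi> W + (real m + 1) * ln S)"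
    using \<Phi>_lower_bound[OF nz hv] \<alpha> by (intro mult_left_mono) (auto simp: S)
  then have low: "2 * min s t \<le> \<alpha> * (\<Phi> W + (real m + 1) * ln S)"
  proof (rule order_trans[rotated])
    have "2 * min s t \<le> 2 * (\<alpha> * ((real m + 1) * min X Y))"
      if "\<alpha> * ((real m + 1) * X) = s" "\<alpha> * ((real m + 1) * Y) = t" for X Y
      using that by (cases "X \<le> Y") auto
    from this[OF s t] show "2 * min s t \<le> \<alpha> * (2 * (real m + 1) * min ((\<Sum>l=0..k. ln (cmod (W l))) / (real k + 1))
      ((\<Sum>l=k+1..m. ln (cmod (W l))) / (real m - real k)))"
      by (simp only: mult_ac)
  qed
  have "exp (- \<alpha> * \<Phi> W) = exp (\<alpha> * (real m + 1) * ln S) * exp (- (\<alpha> * (\<Phi> W + (real m + 1) * ln S)))"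
    by (simp add: exp_add[symmetric] algebra_simps)
  also have "\<dots> \<le> exp (\<alpha> * (real m + 1) * ln S) * exp (- (2 * min s t))"
    using low by simp
  also have "\<dots> \<le> exp (\<alpha> * (real m + 1) * ln S) * (exp (- (2 * s)) + exp (- (2 * t)))"
    by (intro mult_left_mono) (auto simp: min_def)
  also have "exp (\<alpha> * (real m + 1) * ln S) = S ^ (m + 1) * S powr (- ((1 - \<alpha>) * (real m + 1)))"
    using Spos by (simp add: powr_def powr_realpow[symmetric] exp_add[symmetric] algebra_simps del: power_Suc)
  finally have "exp (- \<alpha> * \<Phi> W) \<le> S ^ (m + 1) * (S powr (- sum e {1..m}) * exp (- (2 * s)) + S powr (- sum f {1..m}) * exp (- (2 * t)))"
    by (simp only: e(2) f(2) distrib_left mult.assoc)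
  then have "ennreal (exp (- \<alpha> * \<Phi> W)) \<le> ennreal (S ^ (m + 1)) *
      (ennreal (S powr (- sum e {1..m}) * exp (- (2 * s))) + ennreal (S powr (- sum f {1..m}) * exp (- (2 * t))))"
    using Spos by (simp add: ennreal_mult[symmetric] ennreal_plus[symmetric] ennreal_leI del: ennreal_plus)
  also have "\<dots> \<le> ennreal (S ^ (m + 1)) * (?A + ?B)"
    unfolding S_def s_def t_def L_def using False e(1) f(1)
    by (intro mult_left_mono add_mono prod_pole_weight_ge) auto
  finally show ?thesis by (simp only: W_def S_def \<Phi>_def)
qed

lemma affine_vec_in_chart: "affine_vec m w \<in> chart m 0"
  by (simp add: affine_vec_def chart_def)

lemma volume_density_eq:
  "Determinant.det (mat m m (\<lambda>(a, b). g_comp m (Suc a) (Suc b) (affine_vec m w)))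
    = of_real ((real m + 1) ^ m / (1 + (\<Sum>j=1..m. (cmod (w j))\<^sup>2)) ^ (m + 1))"
proof -
  have S: "sqnorm m (affine_vec m w) = 1 + (\<Sum>j=1..m. (cmod (w j))\<^sup>2)"
    by (simp add: sqnorm_def sum.atLeast_Suc_atMost affine_vec_def)
  have "mat m m (\<lambda>(a, b). g_comp m (Suc a) (Suc b) (affine_vec m w))
     = mat m m (\<lambda>(a, b). of_nat (m + 1) * ((if a = b then 1 else 0) / of_real (1 + (\<Sum>j=1..m. (cmod (w j))\<^sup>2))
           - w (Suc b) * cnj (w (Suc a)) / (of_real (1 + (\<Sum>j=1..m. (cmod (w j))\<^sup>2)))\<^sup>2))"
    by (rule eq_matI) (simp_all add: g_comp_eq[OF affine_vec_in_chart] S chart_idx_def, simp add: affine_vec_def)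
  then show ?thesis
    by (simp only: det_fubini_study) (simp add: add.commute)
qed


text \<open>
  Measurability is required of the bound \<open>B\<close> only, so that of \<open>\<phi>\<close> on the quotient space plays no role.
\<close>

lemma nn_integral_vol_le:
  assumes [measurable]: "B \<in> borel_measurable (\<Pi>\<^sub>M j\<in>{1..m}. lborel)"
    and f: "\<And>w. f (proj_pt m (affine_vec m w)) \<le> ennreal ((1 + (\<Sum>j=1..m. (cmod (w j))\<^sup>2)) ^ (m + 1)) * B w"
  shows "(\<integral>\<^sup>+ p. f p \<partial>vol m) \<le> ennreal ((real m + 1) ^ m) * (\<integral>\<^sup>+ w. B w \<partial>(\<Pi>\<^sub>M j\<in>{1..m}. lborel))"
proof -
  define S where "S w = 1 + (\<Sum>j=1..m. (cmod (w j))\<^sup>2)" for w :: "nat \<Rightarrow> complex"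
  define D where "D w = ennreal ((real m + 1) ^ m / S w ^ (m + 1))" for w
  let ?M = "\<Pi>\<^sub>M j\<in>{1..m}. lborel :: complex measure"
  have Spos: "0 < S w" for w unfolding S_def by (intro add_pos_nonneg sum_nonneg) auto
  have [measurable]: "S \<in> borel_measurable ?M"
    unfolding S_def by measurable
  have [measurable]: "D \<in> borel_measurable ?M" unfolding D_def by measurable
  have vol: "vol m = distr (density ?M D) (cproj_borel m) (\<lambda>w. proj_pt m (affine_vec m w))"
    unfolding vol_def volume_density_eq D_def S_def by simp
  have "(\<integral>\<^sup>+ p. f p \<partial>vol m) \<le> (\<integral>\<^sup>+ w. f (proj_pt m (affine_vec m w)) \<partial>density ?M D)"
    unfolding vol by (rule nn_integral_distr_le) (use measurable_affine_chart[of m] in simp)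
  also have "\<dots> \<le> (\<integral>\<^sup>+ w. ennreal (S w ^ (m + 1)) * B w \<partial>density ?M D)"
    using f unfolding S_def by (intro nn_integral_mono)
  also have "\<dots> = (\<integral>\<^sup>+ w. D w * (ennreal (S w ^ (m + 1)) * B w) \<partial>?M)"
    by (rule nn_integral_density) measurable
  also have "\<dots> = (\<integral>\<^sup>+ w. ennreal ((real m + 1) ^ m) * B w \<partial>?M)"
  proof (rule nn_integral_cong)
    fix w
    have "D w * ennreal (S w ^ (m + 1)) = ennreal ((real m + 1) ^ m)"
      unfolding D_def using Spos[of w] by (subst ennreal_mult[symmetric]) auto
    then show "D w * (ennreal (S w ^ (m + 1)) * B w) = ennreal ((real m + 1) ^ m) * B w"
      by (simp only: mult.assoc[symmetric])
  qed
  also have "\<dots> = ennreal ((real m + 1) ^ m) * (\<integral>\<^sup>+ w. B w \<partial>?M)"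
    by (rule nn_integral_cmult) measurable
  finally show ?thesis .
qed

theorem mainTheorem2:
  fixes m k :: nat and \<alpha> :: real
  assumes "m \<ge> 2" and "k \<in> {1..m - 1}"
    and "\<alpha> < min ((real k + 1) / (real m + 1)) ((real m - real k) / (real m + 1))"
  shows "\<exists>C::real. \<forall>\<phi> :: (nat \<Rightarrow> complex) set \<Rightarrow> real.
           smooth_cproj m \<phi> \<and> admissible m \<phi> \<and> G_invariant m k \<phi> \<and>
           (SUP p\<in>cproj m. ereal (\<phi> p)) = 0 \<longrightarrow>
           (\<integral>\<^sup>+ p. ennreal (exp (- \<alpha> * \<phi> p)) \<partial>vol m) \<le> ennreal C"
proof -
  have km: "k < m" using assms(1,2) by auto
  define \<tau> where "\<tau> = min ((real k + 1) / (real m + 1)) ((real m - real k) / (real m + 1))"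
  (* as \<phi> \<le> 0, the exponent may be increased to a positive one *)
  define \<beta> where "\<beta> = max \<alpha> (\<tau> / 2)"
  have "0 < \<tau>" using km by (simp add: \<tau>_def)
  then have \<beta>: "0 < \<beta>" "\<alpha> \<le> \<beta>" "\<beta> < \<tau>" using assms(3) by (auto simp: \<beta>_def \<tau>_def[symmetric])
  define A where "A = \<beta> * (real m + 1) / (real k + 1)"
  define B where "B = \<beta> * (real m + 1) / (real m - real k)"
  have AB: "0 < A" "A < 1" "0 < B" "B < 1"
    using \<beta> km by (auto simp: A_def B_def \<tau>_def pos_less_divide_eq)
  define a where "a j = (if j \<le> k then A else 0)" for j
  define b where "b j = (if j \<le> k then 0 else B)" for j
  (* the total decay (1 - \<beta>) (m + 1) exceeds what makes all the factors decay like |w_j|^(-2)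
     by 1 - A for the first product and by 1 for the second; each variable gets an m-th of it *)
  define \<delta> where "\<delta> = (1 - A) / real m"
  define \<epsilon> where "\<epsilon> = 1 / real m"
  have m0: "0 < real m" using km by simp
  have \<delta>: "0 < \<delta>" "0 < \<epsilon>" using AB m0 by (auto simp: \<delta>_def \<epsilon>_def)
  define e where "e j = 1 + \<delta> - a j" for j
  define f where "f j = 1 + \<epsilon> - b j" for j
  have sa: "sum a {1..m} = real k * A"
  proof -
    have "sum a {1..m} = sum a {1..k}"
      using km by (intro sum.mono_neutral_right) (auto simp: a_def)
    also have "\<dots> = real k * A" by (simp add: a_def)
    finally show ?thesis .
  qed
  have sb: "sum b {1..m} = \<beta> * (real m + 1)"
  proof -
    have "sum b {1..m} = sum b {k+1..m}"
      by (intro sum.mono_neutral_right) (auto simp: b_def)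
    also have "\<dots> = (real m - real k) * B" using km by (simp add: b_def of_nat_diff)
    finally show ?thesis using km by (simp add: B_def)
  qed
  have kA: "(real k + 1) * A = \<beta> * (real m + 1)" by (simp add: A_def)
  have se: "sum e {1..m} = (1 - \<beta>) * (real m + 1)"
  proof -
    have "sum e {1..m} = (\<Sum>j=1..m. 1 + \<delta> - a j)" by (rule sum.cong[OF refl e_def])
    also have "\<dots> = real m * (1 + \<delta>) - real k * A"
      by (simp only: sum_subtractf sa) simp
    also have "\<dots> = real m + 1 - (real k + 1) * A" using m0 by (simp add: \<delta>_def field_simps)
    finally show ?thesis unfolding kA by (simp add: algebra_simps)
  qed
  have sf: "sum f {1..m} = (1 - \<beta>) * (real m + 1)"
  proof -
    have "sum f {1..m} = (\<Sum>j=1..m. 1 + \<epsilon> - b j)" by (rule sum.cong[OF refl f_def])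
    also have "\<dots> = real m * (1 + \<epsilon>) - \<beta> * (real m + 1)"
      by (simp only: sum_subtractf sb) simp
    also have "\<dots> = (1 - \<beta>) * (real m + 1)" using m0 by (simp add: \<epsilon>_def field_simps)
    finally show ?thesis .
  qed
  have ea: "0 \<le> a j \<and> a j < 1 \<and> 1 < a j + e j" "0 \<le> e j" for j
    using AB \<delta> by (auto simp: e_def a_def)
  have fb: "0 \<le> b j \<and> b j < 1 \<and> 1 < b j + f j" "0 \<le> f j" for j
    using AB \<delta> by (auto simp: f_def b_def)
  define P where "P w = (\<Prod>j=1..m. pole_weight (2 * a j) (2 * e j) (w j))" for w :: "nat \<Rightarrow> complex"
  define Q where "Q w = (\<Prod>j=1..m. pole_weight (2 * b j) (2 * f j) (w j))" for w :: "nat \<Rightarrow> complex"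
  let ?M = "\<Pi>\<^sub>M j\<in>{1..m}. lborel :: complex measure"
  have [measurable]: "P \<in> borel_measurable ?M" "Q \<in> borel_measurable ?M"
    unfolding P_def Q_def by measurable
  define K where "K = ennreal ((real m + 1) ^ m) * (\<integral>\<^sup>+ w. P w + Q w \<partial>?M)"
  have "(\<integral>\<^sup>+ w. P w + Q w \<partial>?M) = (\<integral>\<^sup>+ w. P w \<partial>?M) + (\<integral>\<^sup>+ w. Q w \<partial>?M)"
    by (rule nn_integral_add) measurable
  also have "\<dots> < \<infinity>"
    unfolding P_def Q_def
    using nn_integral_prod_pole_weight[OF _ ea(1), of "{1..m}"] nn_integral_prod_pole_weight[OF _ fb(1), of "{1..m}"]
    by simp
  finally have K: "K < \<infinity>" by (simp add: K_def ennreal_mult_less_top)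
  show ?thesis
  proof (intro exI[of _ "enn2real K"] allI impI)
    fix \<phi> :: "(nat \<Rightarrow> complex) set \<Rightarrow> real"
    assume "smooth_cproj m \<phi> \<and> admissible m \<phi> \<and> G_invariant m k \<phi> \<and> (SUP p\<in>cproj m. ereal (\<phi> p)) = 0"
    then interpret invariant_potential m k \<phi>
      using assms(1) km by unfold_locales auto
    have "(\<integral>\<^sup>+ p. ennreal (exp (- \<alpha> * \<phi> p)) \<partial>vol m) \<le> K"
      unfolding K_def
    proof (rule nn_integral_vol_le)
      fix w
      have "\<phi> (proj_pt m (affine_vec m w)) \<le> 0"
        using \<Phi>_nonpos chart_subset_hvec[OF _ affine_vec_in_chart, of m w] by (simp add: \<Phi>_def)
      then have "ennreal (exp (- \<alpha> * \<phi> (proj_pt m (affine_vec m w)))) \<le> ennreal (exp (- \<beta> * \<phi> (proj_pt m (affine_vec m w))))"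
        using \<beta>(2) by (intro ennreal_leI) (simp add: mult_right_mono_neg)
      also have "\<dots> \<le> ennreal ((1 + (\<Sum>j=1..m. (cmod (w j))\<^sup>2)) ^ (m + 1)) * (P w + Q w)"
        unfolding P_def Q_def
        by (rule exp_neg_le[OF \<beta>(1) _ _ _ se _ sf]) (simp_all add: a_def b_def A_def B_def ea fb)
      finally show "ennreal (exp (- \<alpha> * \<phi> (proj_pt m (affine_vec m w))))
          \<le> ennreal ((1 + (\<Sum>j=1..m. (cmod (w j))\<^sup>2)) ^ (m + 1)) * (P w + Q w)" .
    qed measurable
    also have "K = ennreal (enn2real K)" using K by simp
    finally show "(\<integral>\<^sup>+ p. ennreal (exp (- \<alpha> * \<phi> p)) \<partial>vol m) \<le> ennreal (enn2real K)" .
  qed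
qed

end
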